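(* Let $p>3$ be a prime, let $K$ be a field of characteristic $p$, and let $c\in\mathbf{F}_p\subset K$ be nonzero, expressed as a positive integer with $c<p$. Consider $S_3$ with its trivial representation, the Verma module $M_c=K[x_1,x_2,x_3]$ and its maximal proper graded submodule $J_c$. Define $(d_1,d_2,d_3)$ in the following three cases: (1) if $0<c<p/3$: $(d_1,d_2,d_3)=(p,\,p+3c,\,p+3c)$; (2) if $p/3<c<p/2$: $(d_1,d_2,d_3)=(3c-p,\,3c-p,\,p)$; (3) if $2p/3<c<p$: $(d_1,d_2,d_3)=(p-3c,\,p-3c,\,p)$. Assume that $c$ lies in one of these three ranges and that the Hilbert series of $L_c=M_c/J_c$ agrees with these degrees of generators, i.e. $h_{L_c}(t)=\prod_{i=1}^{3}\frac{1-t^{d_i}}{1-t}$. Then $M_c/J_c$ is a complete intersection, where the generators of $J_c$ have degrees $d_1,d_2,d_3$.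
   Context: Let $K$ be a field of characteristic $p$ and $n=3$. The group $S_n$ acts on $K[x_1,\dots,x_n]$ by permuting the variables; $s_{kj}$ denotes the transposition of $x_k$ and $x_j$. For $c\in K$ the Dunkl operators are $D_k=\frac{\partial}{\partial x_k}-c\sum_{j\neq k}\frac{1}{x_k-x_j}(1-s_{kj})$, $k=1,\dots,n$. The rational Cherednik algebra $H_{1,c}(S_n,\mathfrak h)$, with $\mathfrak h=K^n$ the permutation representation with basis $y_1,\dots,y_n$, acts on the Verma module $M_c=M_c(S_n,\mathfrak h,\mathrm{triv})=K[x_1,\dots,x_n]$ (graded by degree): $x_k$ acts by multiplication, $S_n$ by permutations, and $y_k$ by $D_k$. A graded submodule of $M_c$ is thus a homogeneous ideal stable under $S_n$ and all $D_k$. $J_c$ denotes the unique maximal proper graded submodule of $M_c$, and $L_c=M_c/J_c$. The Hilbert series is $h_{L_c}(t)=\sum_{d\ge 0}\dim_K (L_c)_d\,t^d$. "Complete intersection" means that the quotient of $K[x_1,\dots,x_n]$ is by an ideal generated by a regular sequence. *)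

theory Defs
  imports
    "HOL-Library.Poly_Mapping"
    "HOL-Library.Numeral_Type"
    "HOL-Combinatorics.Permutations"
    "HOL-Computational_Algebra.Computational_Algebra"
begin

section \<open>The polynomial ring\<close>

text \<open>
  The type below is the polynomial ring over \<open>'a\<close> in variables indexed by the finite type \<open>'n\<close>:
  finitely supported functions from exponent vectors to coefficients, with the convolution product.
  The ring \<open>K[x\<^sub>1,x\<^sub>2,x\<^sub>3]\<close> is obtained for \<open>'n = 3\<close>.
\<close>

type_synonym ('n, 'a) mpol = "('n \<Rightarrow>\<^sub>0 nat) \<Rightarrow>\<^sub>0 'a"

definition var :: "'n \<Rightarrow> ('n, 'a::comm_ring_1) mpol" where
  "var i = Poly_Mapping.single (Poly_Mapping.single i 1) 1"

definition const :: "'a::comm_ring_1 \<Rightarrow> ('n, 'a) mpol" where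
  "const a = Poly_Mapping.single 0 a"

abbreviation ideal :: "'r::comm_ring_1 set \<Rightarrow> bool" where
  "ideal \<equiv> module.subspace (*)"

abbreviation ideal_generated :: "'r::comm_ring_1 set \<Rightarrow> 'r set" where
  "ideal_generated \<equiv> module.span (*)"

abbreviation dim_over :: "('n, 'a::field) mpol set \<Rightarrow> nat" where
  "dim_over \<equiv> vector_space.dim (\<lambda>a f. const a * f)"

definition mon_degree :: "('n::finite \<Rightarrow>\<^sub>0 nat) \<Rightarrow> nat" where
  "mon_degree m = (\<Sum>i\<in>UNIV. Poly_Mapping.lookup m i)"

text \<open>Zero is homogeneous of every degree.  Degrees are integers because the degrees in
  \<open>degree_case\<close> below are; for negative \<open>d\<close> only zero is homogeneous of degree \<open>d\<close>.\<close>

definition homogeneous :: "int \<Rightarrow> ('n::finite, 'a::zero) mpol \<Rightarrow> bool" where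
  "homogeneous d f \<longleftrightarrow> (\<forall>m\<in>Poly_Mapping.keys f. int (mon_degree m) = d)"

definition hom_component :: "nat \<Rightarrow> ('n::finite, 'a::comm_ring_1) mpol \<Rightarrow> ('n, 'a) mpol" where
  "hom_component d f =
     (\<Sum>m | m \<in> Poly_Mapping.keys f \<and> mon_degree m = d.
        Poly_Mapping.single m (Poly_Mapping.lookup f m))"

section \<open>Dunkl operators\<close>

text \<open>A permutation \<open>\<sigma>\<close> of the indices acts by \<open>x\<^sub>i \<mapsto> x\<^bsub>\<sigma> i\<^esub>\<close>, i.e. the coefficient of \<open>x\<^sup>m\<close> in
  \<open>permute_vars \<sigma> f\<close> is the coefficient of \<open>x\<^bsup>m \<circ> \<sigma>\<^esup>\<close> in \<open>f\<close>. This is only meaningful for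
  bijective \<open>\<sigma>\<close>.\<close>

definition permute_vars :: "('n \<Rightarrow> 'n) \<Rightarrow> ('n, 'a::zero) mpol \<Rightarrow> ('n, 'a) mpol" where
  "permute_vars \<sigma> = Poly_Mapping.map_key (Poly_Mapping.map_key \<sigma>)"

definition partial_diff :: "'n \<Rightarrow> ('n, 'a::comm_ring_1) mpol \<Rightarrow> ('n, 'a) mpol" where
  "partial_diff k f =
     (\<Sum>m\<in>Poly_Mapping.keys f.
        Poly_Mapping.single (m - Poly_Mapping.single k 1)
          (of_nat (Poly_Mapping.lookup m k) * Poly_Mapping.lookup f m))"

text \<open>The polynomial \<open>(f - s\<^sub>k\<^sub>j f) / (x\<^sub>k - x\<^sub>j)\<close>; see \<open>divided_difference_mult\<close> below.\<close>

definition divided_difference ::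
    "'n \<Rightarrow> 'n \<Rightarrow> ('n, 'a::comm_ring_1) mpol \<Rightarrow> ('n, 'a) mpol" where
  "divided_difference k j f =
     (THE q. (var k - var j) * q = f - permute_vars (transpose k j) f)"

definition dunkl :: "'a::comm_ring_1 \<Rightarrow> 'n::finite \<Rightarrow> ('n, 'a) mpol \<Rightarrow> ('n, 'a) mpol" where
  "dunkl c k f = partial_diff k f - const c * (\<Sum>j\<in>UNIV - {k}. divided_difference k j f)"

section \<open>Graded submodules of the Verma module\<close>

text \<open>The Verma module is the whole polynomial ring, \<open>x\<^sub>k\<close> acting by multiplication,
  the symmetric group by permutations and \<open>y\<^sub>k\<close> by \<open>dunkl c k\<close>.\<close>

definition graded_submodule :: "'a::comm_ring_1 \<Rightarrow> ('n::finite, 'a) mpol set \<Rightarrow> bool" where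
  "graded_submodule c I \<longleftrightarrow>
     ideal I \<and>
     (\<forall>f\<in>I. \<forall>d. hom_component d f \<in> I) \<and>
     (\<forall>\<sigma>. bij \<sigma> \<longrightarrow> (\<forall>f\<in>I. permute_vars \<sigma> f \<in> I)) \<and>
     (\<forall>k. \<forall>f\<in>I. dunkl c k f \<in> I)"

definition maximal_graded_submodule :: "'a::comm_ring_1 \<Rightarrow> ('n::finite, 'a) mpol set \<Rightarrow> bool" where
  "maximal_graded_submodule c J \<longleftrightarrow>
     graded_submodule c J \<and> J \<noteq> UNIV \<and>
     (\<forall>I. graded_submodule c I \<and> I \<noteq> UNIV \<and> J \<subseteq> I \<longrightarrow> I = J)"

text \<open>Existence and uniqueness are \<open>ex1_maximal_graded_submodule\<close> below.\<close>

definition J_max :: "'a::comm_ring_1 \<Rightarrow> ('n::finite, 'a) mpol set" where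
  "J_max c = (THE J. maximal_graded_submodule c J)"

text \<open>For a homogeneous ideal \<open>J\<close>, the degree \<open>d\<close> part of the quotient by \<open>J\<close> is the quotient of
  the finite-dimensional space of forms of degree \<open>d\<close> by those lying in \<open>J\<close>.\<close>

definition quotient_hilbert_series :: "('n::finite, 'a::field) mpol set \<Rightarrow> rat fls" where
  "quotient_hilbert_series J =
     fps_to_fls (Abs_fps (\<lambda>d.
       of_nat (dim_over {f :: ('n, 'a) mpol. homogeneous (int d) f})
       - of_nat (dim_over {f \<in> J. homogeneous (int d) f})))"

section \<open>Complete intersections\<close>

definition regular_sequence :: "'r::comm_ring_1 list \<Rightarrow> bool" where
  "regular_sequence fs \<longleftrightarrow>
     (\<forall>i<length fs. \<forall>g. fs ! i * g \<in> ideal_generated (set (take i fs))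
                        \<longrightarrow> g \<in> ideal_generated (set (take i fs))) \<and>
     ideal_generated (set fs) \<noteq> UNIV"

definition complete_intersection_of_degrees ::
    "int list \<Rightarrow> ('n::finite, 'a::comm_ring_1) mpol set \<Rightarrow> bool" where
  "complete_intersection_of_degrees ds J \<longleftrightarrow>
     (\<exists>fs. regular_sequence fs \<and> J = ideal_generated (set fs) \<and>
           list_all2 (\<lambda>d f. f \<noteq> 0 \<and> homogeneous d f) ds fs)"

section \<open>The degrees\<close>

text \<open>
  In the range \<open>2p/3 < c < p\<close> the degrees are printed as \<open>(p - 3c, p - 3c, p)\<close>. The integer
  \<open>p - 3c\<close> is then negative, so that triple can never match a Hilbert series. The formula
  becomes right when \<open>c\<close> is replaced there by \<open>p - c\<close>, the absolute value of the negative
  representative \<open>c - p\<close>; this gives \<open>p - 3(p - c) = 3c - 2p\<close>.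
  The predicate admits both the printed triple and the corrected one.
\<close>

definition degree_case :: "nat \<Rightarrow> nat \<Rightarrow> int \<Rightarrow> int \<Rightarrow> int \<Rightarrow> bool" where
  "degree_case p c d1 d2 d3 \<longleftrightarrow>
     (0 < c \<and> 3 * c < p \<and>
        (d1, d2, d3) = (int p, int p + 3 * int c, int p + 3 * int c)) \<or>
     (p < 3 * c \<and> 2 * c < p \<and>
        (d1, d2, d3) = (3 * int c - int p, 3 * int c - int p, int p)) \<or>
     (2 * p < 3 * c \<and> c < p \<and>
        ((d1, d2, d3) = (int p - 3 * int c, int p - 3 * int c, int p) \<or>
         (d1, d2, d3) = (3 * int c - 2 * int p, 3 * int c - 2 * int p, int p)))"

section \<open>Well-definedness\<close>

interpretation ring_module: module "(*) :: 'r::comm_ring_1 \<Rightarrow> 'r \<Rightarrow> 'r"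
  by unfold_locales (simp_all add: algebra_simps)

lemma mpol_sum_singles:
  fixes f :: "('n, 'a::comm_ring_1) mpol"
  shows "f = (\<Sum>m\<in>Poly_Mapping.keys f. Poly_Mapping.single m (Poly_Mapping.lookup f m))"
proof (rule poly_mapping_eqI)
  fix k
  show "Poly_Mapping.lookup f k = Poly_Mapping.lookup
     (\<Sum>m\<in>Poly_Mapping.keys f. Poly_Mapping.single m (Poly_Mapping.lookup f m)) k"
    by (auto simp: lookup_sum lookup_single when_def sum.delta in_keys_iff)
qed

lemma inj_map_key:
  assumes "bij \<sigma>"
  shows "inj (Poly_Mapping.map_key \<sigma> :: ('n \<Rightarrow>\<^sub>0 'b::zero) \<Rightarrow> _)"
proof (rule injI)
  fix x y :: "'n \<Rightarrow>\<^sub>0 'b"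
  assume eq: "Poly_Mapping.map_key \<sigma> x = Poly_Mapping.map_key \<sigma> y"
  show "x = y"
  proof (rule poly_mapping_eqI)
    fix k
    obtain i where k: "k = \<sigma> i" using assms by (meson bij_pointE)
    have "Poly_Mapping.lookup (Poly_Mapping.map_key \<sigma> x) i =
        Poly_Mapping.lookup (Poly_Mapping.map_key \<sigma> y) i" using eq by simp
    then show "Poly_Mapping.lookup x k = Poly_Mapping.lookup y k"
      using assms k by (simp add: map_key.rep_eq bij_is_inj)
  qed
qed

lemma lookup_permute_vars:
  "bij \<sigma> \<Longrightarrow> Poly_Mapping.lookup (permute_vars \<sigma> f) m =
    Poly_Mapping.lookup f (Poly_Mapping.map_key \<sigma> m)"
  by (simp add: permute_vars_def map_key.rep_eq inj_map_key)

lemma permute_vars_add: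
  "bij \<sigma> \<Longrightarrow> permute_vars \<sigma> (f + g) = permute_vars \<sigma> f + permute_vars \<sigma> g"
  by (rule poly_mapping_eqI) (simp add: lookup_permute_vars lookup_add)

lemma permute_vars_zero: "bij \<sigma> \<Longrightarrow> permute_vars \<sigma> 0 = 0"
  by (rule poly_mapping_eqI) (simp add: lookup_permute_vars)

lemma hom_component_lookup:
  "Poly_Mapping.lookup (hom_component d f) m =
    (if mon_degree m = d then Poly_Mapping.lookup f m else 0)"
  by (auto simp: hom_component_def lookup_sum lookup_single when_def in_keys_iff sum.delta)

lemma hom_component_add: "hom_component d (f + g) = hom_component d f + hom_component d g"
  by (rule poly_mapping_eqI) (simp add: hom_component_lookup lookup_add)

lemma hom_component_zero: "hom_component d 0 = 0"
  by (rule poly_mapping_eqI) (simp add: hom_component_lookup)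

lemma partial_diff_superset:
  assumes "finite A" "Poly_Mapping.keys f \<subseteq> A"
  shows "partial_diff k f =
     (\<Sum>m\<in>A. Poly_Mapping.single (m - Poly_Mapping.single k 1)
          (of_nat (Poly_Mapping.lookup m k) * Poly_Mapping.lookup f m))"
  unfolding partial_diff_def
  by (rule sum.mono_neutral_left) (use assms in \<open>auto simp: in_keys_iff\<close>)

lemma partial_diff_add: "partial_diff k (f + g) = partial_diff k f + partial_diff k g"
proof -
  let ?A = "Poly_Mapping.keys f \<union> Poly_Mapping.keys g \<union> Poly_Mapping.keys (f + g)"
  show ?thesis
    by (subst (1 2 3) partial_diff_superset[where A = ?A])
      (auto simp: lookup_add distrib_left single_add sum.distrib)
qed

lemma partial_diff_zero: "partial_diff k 0 = 0"
  by (simp add: partial_diff_def)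

lemma var_power: "var i ^ n = Poly_Mapping.single (Poly_Mapping.single i n) 1"
  by (induction n) (simp_all add: var_def mult_single single_add[symmetric])

lemma single_eq_prod_pow:
  fixes m :: "'n \<Rightarrow>\<^sub>0 nat"
  assumes "k \<noteq> j"
  obtains r where
    "Poly_Mapping.single m (a::'a::comm_ring_1) =
       r * (var k ^ Poly_Mapping.lookup m k * var j ^ Poly_Mapping.lookup m j)"
    "permute_vars (transpose k j) (Poly_Mapping.single m a) =
       r * (var j ^ Poly_Mapping.lookup m k * var k ^ Poly_Mapping.lookup m j)"
proof
  let ?l = "Poly_Mapping.lookup"
  let ?s = "Poly_Mapping.single"
  define m' where "m' = m - (?s k (?l m k) + ?s j (?l m j))"
  have m: "m = m' + (?s k (?l m k) + ?s j (?l m j))"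
    using assms
    by (intro poly_mapping_eqI)
      (auto simp: m'_def lookup_add lookup_minus lookup_single when_def)
  show "?s m a = ?s m' a * (var k ^ ?l m k * var j ^ ?l m j)"
    by (simp add: var_power mult_single m[symmetric])
  have inj: "inj (transpose k j)" by simp
  define m2 where "m2 = m' + (?s j (?l m k) + ?s k (?l m j))"
  have mk: "m = Poly_Mapping.map_key (transpose k j) m2"
    using assms
    by (intro poly_mapping_eqI)
      (auto simp: m2_def m'_def map_key.rep_eq lookup_add lookup_minus
         lookup_single when_def transpose_def)
  have "permute_vars (transpose k j) (?s m a) = ?s m2 a"
    unfolding permute_vars_def
    by (subst mk, rule map_key_single) (rule inj_map_key, simp)
  also have "\<dots> = ?s m' a * (var j ^ ?l m k * var k ^ ?l m j)"
    by (simp add: var_power mult_single m2_def)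
  finally show "permute_vars (transpose k j) (?s m a) =
      ?s m' a * (var j ^ ?l m k * var k ^ ?l m j)" .
qed

lemma power_swap_dvd:
  fixes x y :: "'r::comm_ring_1"
  shows "x - y dvd x ^ a * y ^ b - y ^ a * x ^ b"
proof -
  have d: "x - y dvd x ^ n - y ^ n" for n
  proof (induction n)
    case (Suc n)
    have "x ^ Suc n - y ^ Suc n = (x - y) * x ^ n + y * (x ^ n - y ^ n)"
      by (simp add: algebra_simps)
    with Suc show ?case by simp
  qed simp
  have "x ^ a * y ^ b - y ^ a * x ^ b = (x ^ a - y ^ a) * y ^ b - y ^ a * (x ^ b - y ^ b)"
    by (simp add: algebra_simps)
  then show ?thesis by (simp add: d dvd_diff)
qed

lemma divided_difference_exists:
  fixes f :: "('n, 'a::comm_ring_1) mpol"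
  assumes "k \<noteq> j"
  shows "var k - var j dvd f - permute_vars (transpose k j) f"
proof -
  let ?g = "\<lambda>m. Poly_Mapping.single m (Poly_Mapping.lookup f m)"
  have *: "var k - var j dvd ?g m - permute_vars (transpose k j) (?g m)" for m
  proof -
    obtain r where r: "?g m =
       r * (var k ^ Poly_Mapping.lookup m k * var j ^ Poly_Mapping.lookup m j)"
      "permute_vars (transpose k j) (?g m) =
       r * (var j ^ Poly_Mapping.lookup m k * var k ^ Poly_Mapping.lookup m j)"
      using single_eq_prod_pow[OF assms] by metis
    have "?g m - permute_vars (transpose k j) (?g m) =
       r * (var k ^ Poly_Mapping.lookup m k * var j ^ Poly_Mapping.lookup m j -
            var j ^ Poly_Mapping.lookup m k * var k ^ Poly_Mapping.lookup m j)"
      unfolding right_diff_distrib by (rule arg_cong2[where f = minus]) (fact r)+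
    then show ?thesis
      by (simp only: dvd_mult[OF power_swap_dvd])
  qed
  have "var k - var j dvd sum ?g A - permute_vars (transpose k j) (sum ?g A)" if "finite A" for A
    using that
  proof induction
    case (insert m A)
    have "sum ?g (insert m A) - permute_vars (transpose k j) (sum ?g (insert m A)) =
      (?g m - permute_vars (transpose k j) (?g m)) +
      (sum ?g A - permute_vars (transpose k j) (sum ?g A))"
      using insert by (simp add: permute_vars_add)
    then show ?case
      using dvd_add[OF *[of m] insert.IH] by (simp only:)
  qed (simp add: permute_vars_zero)
  from this[of "Poly_Mapping.keys f"] show ?thesis
    by (simp only: mpol_sum_singles[symmetric] finite_keys)
qed

lemma var_diff_nonzero: "k \<noteq> j \<Longrightarrow> (var k - var j :: ('n, 'a::comm_ring_1) mpol) \<noteq> 0"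
proof
  assume "k \<noteq> j" "var k - var j = (0 :: ('n, 'a) mpol)"
  then have "Poly_Mapping.lookup (var k :: ('n, 'a) mpol) (Poly_Mapping.single k 1) =
      Poly_Mapping.lookup (var j :: ('n, 'a) mpol) (Poly_Mapping.single k 1)" by simp
  moreover have "Poly_Mapping.single j (1::nat) \<noteq> Poly_Mapping.single k 1"
  proof
    assume "Poly_Mapping.single j (1::nat) = Poly_Mapping.single k 1"
    then have "Poly_Mapping.lookup (Poly_Mapping.single j (1::nat)) k =
      Poly_Mapping.lookup (Poly_Mapping.single k 1) k" by simp
    with \<open>k \<noteq> j\<close> show False by (simp add: lookup_single)
  qed
  ultimately show False by (simp add: var_def lookup_single)
qed

lemma divided_difference_unique:
  fixes f :: "('n::linorder, 'a::idom) mpol"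
  assumes "k \<noteq> j" "(var k - var j) * q = f - permute_vars (transpose k j) f"
  shows "divided_difference k j f = q"
  unfolding divided_difference_def
proof (rule the_equality)
  fix q' assume "(var k - var j) * q' = f - permute_vars (transpose k j) f"
  with assms(2) have "(var k - var j) * q' = (var k - var j) * q" by simp
  with var_diff_nonzero[OF assms(1)] show "q' = q" by (metis mult_left_cancel)
qed (fact assms(2))

lemma divided_difference_mult:
  fixes f :: "('n::linorder, 'a::idom) mpol"
  assumes "k \<noteq> j"
  shows "(var k - var j) * divided_difference k j f = f - permute_vars (transpose k j) f"
  using divided_difference_exists[OF assms, of f] divided_difference_unique[OF assms]
  by (metis dvdE)

lemma dunkl_add:
  fixes f g :: "('n::{finite,linorder}, 'a::idom) mpol"
  shows "dunkl c k (f + g) = dunkl c k f + dunkl c k g"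
proof -
  have "divided_difference k j (f + g) = divided_difference k j f + divided_difference k j g"
    if "j \<in> UNIV - {k}" for j
    using that
    by (intro divided_difference_unique)
      (auto simp: distrib_left divided_difference_mult permute_vars_add)
  then show ?thesis
    by (simp add: dunkl_def partial_diff_add sum.distrib algebra_simps)
qed

lemma dunkl_zero:
  fixes c :: "'a::idom" and k :: "'n::{finite,linorder}"
  shows "dunkl c k 0 = 0"
proof -
  have "dunkl c k 0 + dunkl c k 0 = dunkl c k 0 + 0"
    unfolding dunkl_add[symmetric] by simp
  then show ?thesis by (rule add_left_imp_eq)
qed

lemma additive_sum:
  assumes "T 0 = (0::'b::comm_monoid_add)" "\<And>f g. T (f + g) = T f + T (g :: 'r::comm_monoid_add)"
  shows "T (sum h A) = (\<Sum>a\<in>A. T (h a))"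
  by (induction A rule: infinite_finite_induct) (simp_all add: assms)

lemma one_in_ideal: "ideal I \<Longrightarrow> 1 \<in> I \<Longrightarrow> I = UNIV"
  using ring_module.subspace_scale[of I 1] by auto

lemma hom_component_0_const:
  fixes f :: "('n::finite, 'a::comm_ring_1) mpol"
  shows "hom_component 0 f = const (Poly_Mapping.lookup f 0)"
proof (rule poly_mapping_eqI)
  fix m :: "'n \<Rightarrow>\<^sub>0 nat"
  have "mon_degree m = 0 \<longleftrightarrow> m = 0"
    by (auto simp: mon_degree_def poly_mapping_eq_iff fun_eq_iff)
  then show "Poly_Mapping.lookup (hom_component 0 f) m =
      Poly_Mapping.lookup (const (Poly_Mapping.lookup f 0)) m"
    by (auto simp: hom_component_lookup const_def lookup_single when_def)
qed

lemma graded_submodule_proper_component: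
  fixes c :: "'a::field"
  assumes "graded_submodule c I" "I \<noteq> UNIV" "f \<in> I"
  shows "hom_component 0 f = 0"
proof (rule ccontr)
  assume ne: "hom_component 0 f \<noteq> 0"
  define a where "a = Poly_Mapping.lookup f 0"
  have a: "hom_component 0 f = const a" by (simp add: hom_component_0_const a_def)
  with ne have "a \<noteq> 0" by (auto simp: const_def)
  have "const a \<in> I" using assms a unfolding graded_submodule_def by metis
  then have "const (inverse a) * const a \<in> I"
    using assms(1) ring_module.subspace_scale unfolding graded_submodule_def by metis
  moreover have "const (inverse a) * const a = (1 :: ('b, 'a) mpol)"
    using \<open>a \<noteq> 0\<close> by (simp add: const_def mult_single)
  ultimately show False
    using assms(1,2) one_in_ideal unfolding graded_submodule_def by metis
qed

lemma ex1_maximal_graded_submodule: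
  fixes c :: "'a::field"
  shows "\<exists>!J :: ('n::{finite,linorder}, 'a) mpol set. maximal_graded_submodule c J"
proof -
  define S where "S = {I :: ('n, 'a) mpol set. graded_submodule c I \<and> I \<noteq> UNIV}"
  define J where "J = ideal_generated (\<Union>S)"
  have idJ: "ideal J" unfolding J_def by (rule ring_module.subspace_span)
  have upper: "I \<subseteq> J" if "I \<in> S" for I
    using that ring_module.span_superset[of "\<Union>S"] by (auto simp: J_def)
  have rep: "\<exists>(t :: ('n, 'a) mpol set) h. f = sum h t \<and> finite t \<and> (\<forall>a\<in>t. \<exists>I\<in>S. h a \<in> I)" if "f \<in> J" for f
  proof -
    have "\<exists>t r. f = (\<Sum>a\<in>t. r a * a) \<and> finite t \<and> t \<subseteq> \<Union>S"
      using that unfolding J_def ring_module.span_explicit by (rule CollectD)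
    then obtain t where "\<exists>r. f = (\<Sum>a\<in>t. r a * a) \<and> finite t \<and> t \<subseteq> \<Union>S"
      by (rule exE)
    then obtain r where "f = (\<Sum>a\<in>t. r a * a) \<and> finite t \<and> t \<subseteq> \<Union>S"
      by (rule exE)
    note tr = this
    note t = tr[THEN conjunct1] tr[THEN conjunct2, THEN conjunct1] tr[THEN conjunct2, THEN conjunct2]
    have "\<forall>a\<in>t. \<exists>I\<in>S. r a * a \<in> I"
    proof
      fix a assume "a \<in> t"
      then obtain I where "I \<in> S" "a \<in> I" using t by auto
      moreover from this have "ideal I" by (auto simp: S_def graded_submodule_def)
      ultimately show "\<exists>I\<in>S. r a * a \<in> I" using ring_module.subspace_scale by blast
    qed
    with t(1,2) show ?thesis by (intro exI[of _ t] exI[of _ "\<lambda>a. r a * a"] conjI)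
  qed
  have closed: "T f \<in> J"
    if "T 0 = 0" "\<And>f g. T (f + g) = T f + T g" "\<And>I f. I \<in> S \<Longrightarrow> f \<in> I \<Longrightarrow> T f \<in> I" "f \<in> J"
    for T f
  proof -
    obtain t :: "('n, 'a) mpol set" and h where t: "f = sum h t" "finite t" "\<forall>a\<in>t. \<exists>I\<in>S. h a \<in> I"
      using rep[OF \<open>f \<in> J\<close>] by metis
    have "T f = (\<Sum>a\<in>t. T (h a))"
      unfolding t(1) by (rule additive_sum[where T = T, OF that(1,2)])
    also have "\<dots> \<in> J"
    proof (rule ring_module.subspace_sum[OF idJ])
      fix a assume "a \<in> t"
      then obtain I where "I \<in> S" "h a \<in> I" using t(3) by blast
      then show "T (h a) \<in> J" using that(3) upper by blast
    qed
    finally show ?thesis .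
  qed
  have gs: "graded_submodule c J"
    unfolding graded_submodule_def
  proof (intro conjI allI impI ballI)
    fix f d assume "f \<in> J"
    show "hom_component d f \<in> J"
      by (rule closed[where T = "hom_component d", OF hom_component_zero hom_component_add _ \<open>f \<in> J\<close>])
        (auto simp: S_def graded_submodule_def)
  next
    fix \<sigma> :: "'n \<Rightarrow> 'n" and f assume "bij \<sigma>" "f \<in> J"
    show "permute_vars \<sigma> f \<in> J"
      by (rule closed[where T = "permute_vars \<sigma>", OF permute_vars_zero[OF \<open>bij \<sigma>\<close>]
          permute_vars_add[OF \<open>bij \<sigma>\<close>] _ \<open>f \<in> J\<close>])
        (use \<open>bij \<sigma>\<close> in \<open>auto simp: S_def graded_submodule_def\<close>)
  next
    fix k f assume "f \<in> J"
    show "dunkl c k f \<in> J"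
      by (rule closed[where T = "dunkl c k", OF dunkl_zero dunkl_add _ \<open>f \<in> J\<close>])
        (auto simp: S_def graded_submodule_def)
  qed (fact idJ)
  have proper: "J \<noteq> UNIV"
  proof
    assume "J = UNIV"
    then obtain t :: "('n, 'a) mpol set" and h where t: "1 = sum h t" "\<forall>a\<in>t. \<exists>I\<in>S. h a \<in> I"
      using rep[of 1] by (metis UNIV_I)
    have "hom_component 0 1 = (\<Sum>a\<in>t. hom_component 0 (h a))"
      unfolding t(1) by (rule additive_sum[where T = "hom_component 0", OF hom_component_zero hom_component_add])
    also have "\<dots> = 0"
    proof (intro sum.neutral ballI)
      fix a assume "a \<in> t"
      then obtain I where "I \<in> S" "h a \<in> I" using t(2) by blast
      then show "hom_component 0 (h a) = 0"
        using graded_submodule_proper_component[of c I "h a"] by (simp add: S_def)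
    qed
    finally have "const 1 = (0 :: ('n, 'a) mpol)"
      by (simp add: hom_component_0_const lookup_one)
    then show False by (simp add: const_def)
  qed
  show ?thesis
  proof (rule ex1I[of _ J])
    show "maximal_graded_submodule c J"
      using gs proper upper unfolding maximal_graded_submodule_def S_def by blast
  next
    fix J' :: "('n, 'a) mpol set" assume "maximal_graded_submodule c J'"
    then show "J' = J"
      using gs proper upper unfolding maximal_graded_submodule_def S_def by blast
  qed
qed

end

theory Submission
  imports Defs
begin

text \<open>
  Put \<open>y = x\<^sub>1 + x\<^sub>2 + x\<^sub>3\<close>, and let \<open>d\<close> be the degree that occurs twice besides \<open>p\<close>. The power \<open>y\<^sup>p\<close> is
  symmetric and has vanishing partial derivatives, so it lies in \<open>J\<close>. The Hilbert series says that
  \<open>J\<close> agrees with \<open>(y\<^sup>p)\<close> below degree \<open>d\<close> and has two further elements in degree \<open>d\<close>. As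
  \<open>\<Sum>\<^sub>k D\<^sub>k = \<Sum>\<^sub>k \<partial>/\<partial>x\<^sub>k\<close> maps degree \<open>d\<close> of \<open>J\<close> into \<open>(y\<^sup>p)\<close>, these two elements may be taken to be
  binary forms \<open>g\<^sub>1, g\<^sub>2\<close> in \<open>a = x\<^sub>1 - x\<^sub>2\<close> and \<open>b = x\<^sub>1 - x\<^sub>3\<close>.

  The quotient by \<open>J\<close> is simple over the Cherednik algebra and lives in degrees up to
  \<open>s = p + 2 d - 3\<close>; therefore its socle as a module over the polynomial ring is concentrated in
  degree \<open>s\<close>. If \<open>g\<^sub>1\<close> and \<open>g\<^sub>2\<close> had a common factor \<open>q\<close> of positive degree, then all multiples of \<open>q\<close>
  in degree \<open>s\<close> would lie in \<open>(y\<^sup>p, g\<^sub>1, g\<^sub>2)\<close>, hence \<open>q \<in> J\<close> by the socle property, although \<open>q\<close> has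
  degree less than \<open>d\<close> and is not divisible by \<open>y\<close>. So \<open>g\<^sub>1\<close> and \<open>g\<^sub>2\<close> are coprime, \<open>y\<^sup>p, g\<^sub>1, g\<^sub>2\<close> is a
  regular sequence in either order, and by the Hilbert series it generates \<open>J\<close>.
\<close>

section \<open>Polynomials\<close>

text \<open>\<open>ring_module.scale_scale\<close> reassociates products to the left and loops with \<open>algebra_simps\<close>.\<close>

declare ring_module.scale_scale [simp del]

abbreviation coef :: "('n, 'a::zero) mpol \<Rightarrow> ('n \<Rightarrow>\<^sub>0 nat) \<Rightarrow> 'a" where
  "coef \<equiv> Poly_Mapping.lookup"

text \<open>A polynomial is a finite sum of terms, so an additive identity needs checking on single
  terms only; for identities about products the induction is nested.\<close>

lemma mpol_single_induct [case_names single add]: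
  fixes f :: "('n, 'a::comm_ring_1) mpol"
  assumes "\<And>m a. P (Poly_Mapping.single m a)" "\<And>f g. P f \<Longrightarrow> P g \<Longrightarrow> P (f + g)"
  shows "P f"
proof -
  have "P (\<Sum>m\<in>A. Poly_Mapping.single m (coef f m))" if "finite A" for A
    using that
  proof induction
    case empty
    show ?case using assms(1)[of 0 0] by simp
  qed (auto intro: assms)
  from this[of "Poly_Mapping.keys f"] show ?thesis
    using mpol_sum_singles[of f] by simp
qed

lemma prod_singles:
  "(\<Prod>i\<in>A. Poly_Mapping.single (m i) (1::'a::comm_ring_1)) =
    Poly_Mapping.single (\<Sum>i\<in>A. m i :: 'n \<Rightarrow>\<^sub>0 nat) 1"
  by (induction A rule: infinite_finite_induct) (simp_all add: mult_single)

lemma single_eq_prod_var: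
  fixes m :: "'n::finite \<Rightarrow>\<^sub>0 nat" and a :: "'a::comm_ring_1"
  shows "Poly_Mapping.single m a = const a * (\<Prod>i\<in>UNIV. var i ^ Poly_Mapping.lookup m i)"
proof -
  have "(\<Sum>i\<in>UNIV. Poly_Mapping.single i (Poly_Mapping.lookup m i)) = m"
    by (rule poly_mapping_eqI) (simp add: lookup_sum lookup_single when_def)
  then show ?thesis
    by (simp add: var_power prod_singles const_def mult_single)
qed

lemma const_add: "const (a + b) = const a + const b"
  by (simp add: const_def single_add)

lemma const_mult: "const (a * b) = const a * const b"
  by (simp add: const_def mult_single)

lemma const_0 [simp]: "const 0 = 0"
  by (simp add: const_def)

lemma const_1 [simp]: "const 1 = 1"
  by (simp add: const_def)

lemma const_of_nat: "const (of_nat n) = of_nat n"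
  by (simp add: const_def)

lemma const_eq_0_iff [simp]: "const a = (0 :: ('n, 'a::comm_ring_1) mpol) \<longleftrightarrow> a = 0"
  by (metis const_0 const_def lookup_single_eq lookup_zero)

lemma mpol_induct [case_names const var add mult]:
  fixes f :: "('n::finite, 'a::comm_ring_1) mpol"
  assumes const: "\<And>a. P (const a)" and var: "\<And>i. P (var i)"
    and add: "\<And>f g. P f \<Longrightarrow> P g \<Longrightarrow> P (f + g)" and mult: "\<And>f g. P f \<Longrightarrow> P g \<Longrightarrow> P (f * g)"
  shows "P f"
proof (induction f rule: mpol_single_induct)
  case (single m a)
  have one: "P 1" using const[of 1] by simp
  have "P (var i ^ n)" for i n
    by (induction n) (auto intro: one mult var)
  then have "P (\<Prod>i\<in>A. var i ^ Poly_Mapping.lookup m i)" for A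
    by (induction A rule: infinite_finite_induct) (auto intro: one mult)
  then show ?case
    unfolding single_eq_prod_var by (intro mult const)
qed (rule add)

section \<open>Substitution homomorphisms\<close>

definition subst :: "('n::finite \<Rightarrow> ('n, 'a::comm_ring_1) mpol) \<Rightarrow> ('n, 'a) mpol \<Rightarrow> ('n, 'a) mpol" where
  "subst x f = (\<Sum>m\<in>Poly_Mapping.keys f. const (coef f m) * (\<Prod>i\<in>UNIV. x i ^ Poly_Mapping.lookup m i))"

lemma subst_superset:
  assumes "finite A" "Poly_Mapping.keys f \<subseteq> A"
  shows "subst x f = (\<Sum>m\<in>A. const (coef f m) * (\<Prod>i\<in>UNIV. x i ^ Poly_Mapping.lookup m i))"
  unfolding subst_def
  by (rule sum.mono_neutral_left) (use assms in \<open>auto simp: in_keys_iff\<close>)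

lemma subst_add: "subst x (f + g) = subst x f + subst x g"
proof -
  let ?A = "Poly_Mapping.keys f \<union> Poly_Mapping.keys g \<union> Poly_Mapping.keys (f + g)"
  show ?thesis
    by (subst (1 2 3) subst_superset[where A = ?A])
      (auto simp: lookup_add distrib_right const_add sum.distrib)
qed

lemma subst_single:
  "subst x (Poly_Mapping.single m a) = const a * (\<Prod>i\<in>UNIV. x i ^ Poly_Mapping.lookup m i)"
  by (cases "a = 0") (simp_all add: subst_def)

lemma subst_0 [simp]: "subst x 0 = 0"
  by (simp add: subst_def)

lemma subst_const [simp]: "subst x (const a) = const a"
  by (simp add: const_def subst_single)

lemma subst_1 [simp]: "subst x 1 = 1"
  using subst_const[of x 1] by simp

lemma subst_var [simp]: "subst x (var j) = x j"
proof -
  have "subst x (var j) = (\<Prod>i\<in>UNIV. if i = j then x i else 1)"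
    unfolding var_def subst_single const_1 mult_1_left
    by (rule prod.cong) (auto simp: lookup_single when_def)
  then show ?thesis by simp
qed

lemma subst_mult: "subst x (f * g) = subst x f * subst x g"
proof (induction f rule: mpol_single_induct)
  case (single m a)
  show ?case
  proof (induction g rule: mpol_single_induct)
    case (single n b)
    show ?case
      by (simp add: mult_single subst_single const_mult lookup_add power_add prod.distrib)
  next
    case (add g h)
    then show ?case by (simp add: distrib_left subst_add)
  qed
next
  case (add f h)
  then show ?case by (simp add: distrib_right subst_add)
qed

lemma subst_uminus: "subst x (- f) = - subst x f"
  by (metis subst_add subst_0 add.right_inverse minus_unique)

lemma subst_diff: "subst x (f - g) = subst x f - subst x g"
  using subst_add[of x f "- g"] by (simp add: subst_uminus)

lemma subst_power: "subst x (f ^ n) = subst x f ^ n"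
  by (induction n) (simp_all add: subst_mult)

lemma subst_sum: "subst x (sum h A) = (\<Sum>a\<in>A. subst x (h a))"
  by (induction A rule: infinite_finite_induct) (simp_all add: subst_add)

text \<open>Modulo \<open>l\<close> the substitution and the identity are ring homomorphisms that
  agree on the variables, hence everywhere. The divisibility tests for \<open>mpol_y\<close> and
  \<open>mpol_a\<close> rest on this.\<close>

lemma dvd_diff_subst:
  assumes "\<And>i. l dvd var i - x i"
  shows "l dvd f - subst x f"
proof (induction f rule: mpol_induct)
  case (add f g)
  have "f + g - subst x (f + g) = (f - subst x f) + (g - subst x g)"
    by (simp add: subst_add)
  with add show ?case by (metis dvd_add)
next
  case (mult f g)
  have "f * g - subst x (f * g) = f * (g - subst x g) + subst x g * (f - subst x f)"
    by (simp add: subst_mult algebra_simps)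
  with mult show ?case by (metis dvd_add dvd_mult)
qed (use assms in auto)

section \<open>Homogeneous polynomials and components\<close>

lemma homogeneous_iff_hom_component: "homogeneous (int d) f \<longleftrightarrow> hom_component d f = f"
  by (auto simp: homogeneous_def poly_mapping_eq_iff fun_eq_iff hom_component_lookup in_keys_iff)

lemma hom_component_homogeneous:
  "homogeneous (int d) f \<Longrightarrow> hom_component e f = (if e = d then f else 0)"
  by (rule poly_mapping_eqI) (auto simp: homogeneous_def hom_component_lookup in_keys_iff)

lemma homogeneous_hom_component [simp]: "homogeneous (int d) (hom_component d f)"
  by (auto simp: homogeneous_def hom_component_lookup in_keys_iff split: if_splits)

lemma mon_degree_add: "mon_degree (m + n) = mon_degree m + mon_degree n"
  by (simp add: mon_degree_def lookup_add sum.distrib)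

lemma mon_degree_single: "mon_degree (Poly_Mapping.single i n) = n"
  by (simp add: mon_degree_def lookup_single when_def)

lemma mon_degree_0 [simp]: "mon_degree 0 = 0"
  by (simp add: mon_degree_def)

lemma homogeneous_0 [simp]: "homogeneous d 0"
  by (simp add: homogeneous_def)

lemma homogeneous_single: "homogeneous (int (mon_degree m)) (Poly_Mapping.single m a)"
  by (simp add: homogeneous_def)

lemma homogeneous_add: "homogeneous d f \<Longrightarrow> homogeneous d g \<Longrightarrow> homogeneous d (f + g)"
  unfolding homogeneous_def using keys_add[of f g] by blast

lemma homogeneous_sum: "(\<And>i. i \<in> A \<Longrightarrow> homogeneous d (h i)) \<Longrightarrow> homogeneous d (sum h A)"
  by (induction A rule: infinite_finite_induct) (auto intro: homogeneous_add)

lemma homogeneous_uminus: "homogeneous d f \<Longrightarrow> homogeneous d (- f)"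
  for f :: "('n::finite, 'a::comm_ring_1) mpol"
  by (auto simp: homogeneous_def in_keys_iff)

lemma homogeneous_diff: "homogeneous d f \<Longrightarrow> homogeneous d g \<Longrightarrow> homogeneous d (f - g)"
  for f :: "('n::finite, 'a::comm_ring_1) mpol"
  using homogeneous_add[of d f "- g"] homogeneous_uminus by fastforce

lemma homogeneous_mult:
  assumes "homogeneous d f" "homogeneous e g"
  shows "homogeneous (d + e) (f * g)"
  unfolding homogeneous_def
proof
  fix m assume "m \<in> Poly_Mapping.keys (f * g)"
  with keys_mult[of f g] obtain a b where "m = a + b" "a \<in> Poly_Mapping.keys f" "b \<in> Poly_Mapping.keys g"
    by blast
  with assms show "int (mon_degree m) = d + e"
    by (auto simp: homogeneous_def mon_degree_add)
qed

lemma homogeneous_const: "homogeneous 0 (const a)"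
  unfolding const_def by (simp add: homogeneous_def)

lemma homogeneous_1: "homogeneous 0 (1 :: ('n::finite, 'a::comm_ring_1) mpol)"
  using homogeneous_const[of 1] by simp

lemma homogeneous_var: "homogeneous 1 (var i)"
  by (simp add: var_def homogeneous_def mon_degree_single)

lemma homogeneous_power: "homogeneous d f \<Longrightarrow> homogeneous (int n * d) (f ^ n)"
  for f :: "('n::finite, 'a::comm_ring_1) mpol"
proof (induction n)
  case (Suc n)
  then show ?case using homogeneous_mult[of d f "int n * d" "f ^ n"] by (simp add: algebra_simps)
qed (simp add: homogeneous_1)

lemma homogeneous_const_mult: "homogeneous d f \<Longrightarrow> homogeneous d (const a * f)"
  using homogeneous_mult[OF homogeneous_const, of d f a] by simp

lemma homogeneous_degree_0:
  fixes f :: "('n::finite, 'a::comm_ring_1) mpol"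
  assumes "homogeneous 0 f"
  shows "f = const (coef f 0)"
  using homogeneous_iff_hom_component[of 0 f] assms by (simp add: hom_component_0_const)

lemma hom_component_sum: "hom_component d (sum h A) = (\<Sum>i\<in>A. hom_component d (h i))"
  by (induction A rule: infinite_finite_induct) (simp_all add: hom_component_add hom_component_zero)

lemma hom_component_uminus: "hom_component d (- f) = - hom_component d f"
  by (rule poly_mapping_eqI) (simp add: hom_component_lookup)

lemma hom_component_diff: "hom_component d (f - g) = hom_component d f - hom_component d g"
  using hom_component_add[of d f "- g"] by (simp add: hom_component_uminus)

lemma hom_component_mult_homogeneous:
  fixes f g :: "('n::finite, 'a::comm_ring_1) mpol"
  assumes "homogeneous (int e) f"
  shows "hom_component d (f * g) = (if e \<le> d then f * hom_component (d - e) g else 0)"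
proof (induction g rule: mpol_single_induct)
  case (single m a)
  let ?g = "Poly_Mapping.single m a"
  have 1: "homogeneous (int (e + mon_degree m)) (f * ?g)"
    using homogeneous_mult[OF assms homogeneous_single] by simp
  show ?case
    unfolding hom_component_homogeneous[OF 1] hom_component_homogeneous[OF homogeneous_single] by auto
next
  case (add g h)
  then show ?case by (simp add: distrib_left hom_component_add)
qed

section \<open>Dunkl operators\<close>

lemma permute_vars_single:
  assumes "bij \<sigma>"
  shows "permute_vars \<sigma> (Poly_Mapping.single m a) = Poly_Mapping.single (Poly_Mapping.map_key (inv \<sigma>) m) a"
proof (rule poly_mapping_eqI)
  fix n
  have "Poly_Mapping.map_key \<sigma> n = m \<longleftrightarrow> n = Poly_Mapping.map_key (inv \<sigma>) m"
    using assms
    by (auto simp: poly_mapping_eq_iff fun_eq_iff map_key.rep_eq bij_is_inj bij_imp_bij_inv)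
      (metis bij_inv_eq_iff)+
  then show "coef (permute_vars \<sigma> (Poly_Mapping.single m a)) n =
      coef (Poly_Mapping.single (Poly_Mapping.map_key (inv \<sigma>) m) a) n"
    using assms by (auto simp: lookup_permute_vars lookup_single when_def)
qed

lemma permute_vars_mult:
  fixes f g :: "('n, 'a::comm_ring_1) mpol"
  assumes "bij \<sigma>"
  shows "permute_vars \<sigma> (f * g) = permute_vars \<sigma> f * permute_vars \<sigma> g"
proof (induction f rule: mpol_single_induct)
  case (single m a)
  show ?case
  proof (induction g rule: mpol_single_induct)
    case (single n b)
    show ?case
      using assms
      by (simp add: mult_single permute_vars_single map_key_plus bij_imp_bij_inv bij_is_inj)
  next
    case (add g h)
    then show ?case by (simp add: distrib_left permute_vars_add assms)
  qed
next
  case (add f h)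
  then show ?case by (simp add: distrib_right permute_vars_add assms)
qed

lemma permute_vars_const: "bij \<sigma> \<Longrightarrow> permute_vars \<sigma> (const a) = const a"
  by (simp add: const_def permute_vars_single bij_is_inj bij_imp_bij_inv)

lemma permute_vars_1: "bij \<sigma> \<Longrightarrow> permute_vars \<sigma> (1 :: ('n, 'a::comm_ring_1) mpol) = 1"
  using permute_vars_const[of \<sigma> 1] by simp

lemma permute_vars_var:
  assumes "bij \<sigma>"
  shows "permute_vars \<sigma> (var i) = var (\<sigma> i)"
proof -
  have "Poly_Mapping.map_key (inv \<sigma>) (Poly_Mapping.single i 1) = (Poly_Mapping.single (\<sigma> i) 1 :: _ \<Rightarrow>\<^sub>0 nat)"
    using assms
    by (auto simp: poly_mapping_eq_iff fun_eq_iff map_key.rep_eq bij_is_inj bij_imp_bij_inv lookup_single when_def)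
      (auto simp: bij_is_surj surj_f_inv_f bij_is_inj)
  then show ?thesis
    using assms by (simp add: var_def permute_vars_single)
qed

lemma permute_vars_power:
  "bij \<sigma> \<Longrightarrow> permute_vars \<sigma> (f ^ n) = permute_vars \<sigma> f ^ n"
  for f :: "('n, 'a::comm_ring_1) mpol"
  by (induction n) (simp_all add: permute_vars_1 permute_vars_mult)

lemma permute_vars_sum: "bij \<sigma> \<Longrightarrow> permute_vars \<sigma> (sum h A) = (\<Sum>a\<in>A. permute_vars \<sigma> (h a))"
  by (rule additive_sum[where T = "permute_vars \<sigma>"]) (simp_all add: permute_vars_zero permute_vars_add)

lemma mon_degree_map_key:
  fixes m :: "'n::finite \<Rightarrow>\<^sub>0 nat"
  assumes "bij \<sigma>"
  shows "mon_degree (Poly_Mapping.map_key \<sigma> m) = mon_degree m"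
proof -
  have "mon_degree (Poly_Mapping.map_key \<sigma> m) = (\<Sum>i\<in>UNIV. Poly_Mapping.lookup m (\<sigma> i))"
    using assms by (simp add: mon_degree_def map_key.rep_eq bij_is_inj)
  also have "\<dots> = mon_degree m"
    unfolding mon_degree_def by (rule sum.reindex_bij_betw[OF assms])
  finally show ?thesis .
qed

lemma hom_component_permute_vars:
  "bij \<sigma> \<Longrightarrow> hom_component d (permute_vars \<sigma> f) = permute_vars \<sigma> (hom_component d f)"
  for f :: "('n::finite, 'a::comm_ring_1) mpol"
  by (rule poly_mapping_eqI) (simp add: hom_component_lookup lookup_permute_vars mon_degree_map_key)

section \<open>Partial derivatives\<close>

lemma partial_diff_single:
  "partial_diff k (Poly_Mapping.single m a) =
    Poly_Mapping.single (m - Poly_Mapping.single k 1) (of_nat (Poly_Mapping.lookup m k) * a)"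
  by (cases "a = 0") (simp_all add: partial_diff_def)

text \<open>Subtraction of exponents is truncated, so it can be moved past \<open>n\<close> only if
  the variable \<open>k\<close> occurs in \<open>m\<close>. In the product rule the other terms
  carry the factor \<open>of_nat 0\<close>.\<close>

lemma monomial_diff_add:
  fixes m n :: "'n \<Rightarrow>\<^sub>0 nat"
  assumes "Poly_Mapping.lookup m k \<noteq> 0"
  shows "m - Poly_Mapping.single k 1 + n = m + n - Poly_Mapping.single k 1"
  using assms by (intro poly_mapping_eqI) (auto simp: lookup_add lookup_minus lookup_single when_def)

lemma partial_diff_mult:
  "partial_diff k (f * g) = partial_diff k f * g + f * partial_diff k g"
proof (induction f rule: mpol_single_induct)
  case (single m a)
  show ?case
  proof (induction g rule: mpol_single_induct)
    case (single n b)
    let ?d = "\<lambda>m. m - Poly_Mapping.single k 1" and ?l = "\<lambda>m. Poly_Mapping.lookup m k"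
    have 1: "Poly_Mapping.single (?d m + n) (of_nat (?l m) * a * b) =
        Poly_Mapping.single (?d (m + n)) (of_nat (?l m) * a * b)"
      using monomial_diff_add[of m k n] by (cases "?l m = 0") simp_all
    have 2: "Poly_Mapping.single (m + ?d n) (a * (of_nat (?l n) * b)) =
        Poly_Mapping.single (?d (m + n)) (a * (of_nat (?l n) * b))"
      using monomial_diff_add[of n k m] by (cases "?l n = 0") (simp_all add: add.commute)
    show ?case
      unfolding mult_single partial_diff_single 1 2 lookup_add
      by (simp add: single_add[symmetric] algebra_simps)
  next
    case (add g h)
    then show ?case by (simp add: distrib_left partial_diff_add algebra_simps)
  qed
next
  case (add f h)
  then show ?case by (simp add: distrib_right partial_diff_add algebra_simps)
qed

lemma partial_diff_const [simp]: "partial_diff k (const a) = 0"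
  by (simp add: const_def partial_diff_single)

lemma partial_diff_1 [simp]: "partial_diff k 1 = 0"
  using partial_diff_const[of k 1] by simp

lemma partial_diff_var: "partial_diff k (var i) = of_bool (i = k)"
  by (auto simp: var_def partial_diff_single lookup_single when_def)

lemma partial_diff_power: "partial_diff k (f ^ Suc n) = of_nat (Suc n) * f ^ n * partial_diff k f"
proof (induction n)
  case (Suc n)
  have "partial_diff k (f ^ Suc (Suc n)) = partial_diff k f * f ^ Suc n + f * partial_diff k (f ^ Suc n)"
    by (simp only: power_Suc partial_diff_mult)
  also have "\<dots> = of_nat (Suc (Suc n)) * f ^ Suc n * partial_diff k f"
    unfolding Suc by (simp add: algebra_simps)
  finally show ?case .
qed simp

lemma hom_component_partial_diff:
  "hom_component d (partial_diff k f) = partial_diff k (hom_component (Suc d) f)"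
proof (induction f rule: mpol_single_induct)
  case (single m a)
  let ?m = "m - Poly_Mapping.single k 1"
  show ?case
  proof (cases "Poly_Mapping.lookup m k = 0")
    case True
    then show ?thesis
      unfolding hom_component_homogeneous[OF homogeneous_single] partial_diff_single
      by (auto simp: hom_component_zero partial_diff_zero partial_diff_single)
  next
    case False
    then have "m = ?m + Poly_Mapping.single k 1"
      by (intro poly_mapping_eqI) (auto simp: lookup_add lookup_minus lookup_single when_def)
    then have "mon_degree m = Suc (mon_degree ?m)"
      by (metis mon_degree_add mon_degree_single Suc_eq_plus1)
    then show ?thesis
      unfolding hom_component_homogeneous[OF homogeneous_single] partial_diff_single
      by (auto simp: partial_diff_zero partial_diff_single)
  qed
next
  case (add f g)
  then show ?case by (simp add: hom_component_add partial_diff_add)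
qed

section \<open>Divided differences\<close>

context
  fixes k j :: "'n::{finite,linorder}"
  assumes kj: "k \<noteq> j"
begin

text \<open>Twisted Leibniz rule: with \<open>s\<close> the transposition,
  \<open>f g - (s f) (s g) = f (g - s g) + (f - s f) (s g)\<close>.\<close>

lemma divided_difference_product:
  fixes f g :: "('n, 'a::idom) mpol"
  shows "divided_difference k j (f * g) =
    f * divided_difference k j g + divided_difference k j f * permute_vars (transpose k j) g"
proof (rule divided_difference_unique[OF kj])
  show "(var k - var j) * (f * divided_difference k j g +
      divided_difference k j f * permute_vars (transpose k j) g) =
    f * g - permute_vars (transpose k j) (f * g)"
  proof -
    have "(var k - var j) * (f * divided_difference k j g +
        divided_difference k j f * permute_vars (transpose k j) g) =
      f * ((var k - var j) * divided_difference k j g) +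
      ((var k - var j) * divided_difference k j f) * permute_vars (transpose k j) g"
      by (simp only: algebra_simps)
    also have "\<dots> = f * g - permute_vars (transpose k j) (f * g)"
      unfolding divided_difference_mult[OF kj] permute_vars_mult[OF bij_transpose]
      by (simp add: algebra_simps)
    finally show ?thesis .
  qed
qed

lemma divided_difference_symmetric:
  fixes f :: "('n, 'a::idom) mpol"
  assumes "permute_vars (transpose k j) f = f"
  shows "divided_difference k j f = 0"
  by (rule divided_difference_unique[OF kj]) (simp add: assms)

lemma divided_difference_var:
  "divided_difference k j (var i :: ('n, 'a::idom) mpol) =
    const (if i = k then 1 else if i = j then - 1 else 0)"
  by (rule divided_difference_unique[OF kj])
    (use kj in \<open>auto simp: permute_vars_var transpose_def const_def single_uminus\<close>)

lemma divided_difference_swap: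
  fixes f :: "('n, 'a::idom) mpol"
  shows "divided_difference j k f = - divided_difference k j f"
proof (rule divided_difference_unique)
  have "(var j - var k) * - divided_difference k j f = (var k - var j) * divided_difference k j f"
    by (simp add: algebra_simps)
  then show "(var j - var k) * - divided_difference k j f = f - permute_vars (transpose j k) f"
    unfolding divided_difference_mult[OF kj] by (simp add: transpose_commute)
qed (use kj in simp)

lemma hom_component_divided_difference:
  fixes f :: "('n, 'a::idom) mpol"
  shows "hom_component d (divided_difference k j f) = divided_difference k j (hom_component (Suc d) f)"
proof (rule sym, rule divided_difference_unique[OF kj])
  have "homogeneous (int 1) (var k - var j :: ('n, 'a) mpol)"
    by (simp add: homogeneous_diff homogeneous_var)
  from hom_component_mult_homogeneous[OF this, of "Suc d" "divided_difference k j f"]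
  show "(var k - var j) * hom_component d (divided_difference k j f) =
    hom_component (Suc d) f - permute_vars (transpose k j) (hom_component (Suc d) f)"
    unfolding divided_difference_mult[OF kj] hom_component_diff hom_component_permute_vars[OF bij_transpose]
    by simp
qed

end

section \<open>Commutation rules\<close>

context
  fixes c :: "'a::idom"
begin

lemma hom_component_dunkl:
  fixes f :: "('n::{finite,linorder}, 'a) mpol"
  shows "hom_component d (dunkl c k f) = dunkl c k (hom_component (Suc d) f)"
proof -
  have "hom_component d (const c * g) = const c * hom_component d g" for g :: "('n, 'a) mpol"
    using hom_component_mult_homogeneous[of 0 "const c" d g] by (simp add: homogeneous_const)
  then show ?thesis
    by (simp add: dunkl_def hom_component_diff hom_component_partial_diff hom_component_sum
        hom_component_divided_difference)
qed

text \<open>A symmetric factor passes through every divided difference, and its Leibniz term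
  vanishes. This makes the ideal of \<open>mpol_y ^ p\<close> stable under the Dunkl
  operators.\<close>

lemma dunkl_symmetric_mult:
  fixes f g :: "('n::{finite,linorder}, 'a) mpol"
  assumes "\<And>i j. permute_vars (transpose i j) f = f" "partial_diff k f = 0"
  shows "dunkl c k (f * g) = f * dunkl c k g"
proof -
  have "divided_difference k j (f * g) = f * divided_difference k j g" if "k \<noteq> j" for j
    using that assms(1) by (simp add: divided_difference_product divided_difference_symmetric)
  then show ?thesis
    using assms(2) by (simp add: dunkl_def partial_diff_mult sum_distrib_left algebra_simps)
qed

text \<open>This is the commutation relation of \<open>y_k\<close> and \<open>x_i\<close> in the
  Cherednik algebra: the corrections are multiples of \<open>f\<close> and of transposed copies of
  \<open>f\<close>.\<close>

lemma dunkl_var_mult: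
  fixes f :: "('n::{finite,linorder}, 'a) mpol"
  shows "dunkl c k (var i * f) = var i * dunkl c k f + of_bool (i = k) * f -
    const c * (\<Sum>j\<in>UNIV - {k}. const (if i = k then 1 else if i = j then - 1 else 0) *
      permute_vars (transpose k j) f)"
proof -
  have "(\<Sum>j\<in>UNIV - {k}. divided_difference k j (var i * f)) =
    var i * (\<Sum>j\<in>UNIV - {k}. divided_difference k j f) +
    (\<Sum>j\<in>UNIV - {k}. const (if i = k then 1 else if i = j then - 1 else 0) *
      permute_vars (transpose k j) f)"
    unfolding sum_distrib_left sum.distrib[symmetric]
    by (rule sum.cong) (simp_all add: divided_difference_product divided_difference_var)
  then show ?thesis
    unfolding dunkl_def partial_diff_mult partial_diff_var
    by (simp add: algebra_simps)
qed

end

lemma self_eq_uminusD: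
  fixes f :: "('n::linorder, 'a::idom) mpol"
  assumes "(2 :: 'a) \<noteq> 0" "f = - f"
  shows "f = 0"
proof (rule poly_mapping_eqI)
  fix m
  have "coef f m = - coef f m"
    by (metis assms(2) lookup_uminus)
  then have "2 * coef f m = 0"
    by (metis add.right_inverse mult_2)
  then show "coef f m = coef 0 m"
    using assms(1) by simp
qed

text \<open>Divided differences are antisymmetric in their two indices, so exchanging the summations
  turns the sum into its negative.\<close>

lemma sum_divided_differences:
  fixes f :: "('n::{finite,linorder}, 'a::idom) mpol"
  assumes "(2 :: 'a) \<noteq> 0"
  shows "(\<Sum>k\<in>UNIV. \<Sum>j\<in>UNIV - {k}. divided_difference k j f) = 0" (is "?s = 0")
proof -
  \<comment> \<open>Zeros on the diagonal make the index set a full square, as the exchange of sums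
    requires.\<close>
  have "?s = (\<Sum>k\<in>UNIV. \<Sum>j\<in>UNIV. if j = k then 0 else divided_difference k j f)"
    by (intro sum.cong sum.mono_neutral_cong_left) auto
  also have "\<dots> = (\<Sum>j\<in>UNIV. \<Sum>k\<in>UNIV. if j = k then 0 else divided_difference k j f)"
    by (rule sum.swap)
  also have "\<dots> = (\<Sum>j\<in>UNIV. \<Sum>k\<in>UNIV - {j}. divided_difference k j f)"
    by (intro sum.cong sum.mono_neutral_cong_right) auto
  also have "\<dots> = (\<Sum>j\<in>UNIV. \<Sum>k\<in>UNIV - {j}. - divided_difference j k f)"
    by (intro sum.cong refl divided_difference_swap) auto
  also have "\<dots> = - ?s"
    by (simp add: sum_negf)
  finally show ?thesis
    by (rule self_eq_uminusD[OF assms])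
qed

text \<open>The reflection terms cancel, so this sum of Dunkl operators is a derivation with the
  ordinary Leibniz rule.\<close>

lemma sum_dunkl:
  fixes f :: "('n::{finite,linorder}, 'a::idom) mpol"
  assumes "(2 :: 'a) \<noteq> 0"
  shows "(\<Sum>k\<in>UNIV. dunkl c k f) = (\<Sum>k\<in>UNIV. partial_diff k f)"
  using sum_divided_differences[OF assms, of f]
  by (simp add: dunkl_def sum_subtractf sum_distrib_left[symmetric])

section \<open>The maximal graded submodule\<close>

lemma const_uminus: "const (- a) = - const a"
  by (simp add: const_def single_uminus)

lemma maximal_graded_submodule_J_max:
  fixes c :: "'a::field"
  shows "maximal_graded_submodule c (J_max c :: ('n::{finite,linorder}, 'a) mpol set)"
  unfolding J_max_def by (rule theI'[OF ex1_maximal_graded_submodule])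

context
  fixes c :: "'a::field" and J :: "('n::{finite,linorder}, 'a) mpol set"
  assumes J: "J = J_max c"
begin

lemma graded_submodule_J_max: "graded_submodule c J" and J_max_proper: "J \<noteq> UNIV"
  using maximal_graded_submodule_J_max[of c, where 'n = 'n]
  unfolding maximal_graded_submodule_def J by auto

lemma ideal_J_max: "ideal J"
  and hom_component_J_max: "f \<in> J \<Longrightarrow> hom_component d f \<in> J"
  and permute_vars_J_max: "bij \<sigma> \<Longrightarrow> f \<in> J \<Longrightarrow> permute_vars \<sigma> f \<in> J"
  and dunkl_J_max: "f \<in> J \<Longrightarrow> dunkl c k f \<in> J"
  using graded_submodule_J_max unfolding graded_submodule_def by auto

text \<open>The sum \<open>I + J\<close> is again a graded submodule, and it is proper because the
  degree 0 components of elements of \<open>I\<close> and of \<open>J\<close> vanish. Maximality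
  forces \<open>I + J = J\<close>.\<close>

lemma graded_submodule_subset_J_max:
  assumes I: "graded_submodule c I" "I \<noteq> UNIV"
  shows "I \<subseteq> J"
proof -
  define S where "S = {f + g | f g. f \<in> I \<and> g \<in> J}"
  have S_I: "f \<in> S" if "f \<in> I" for f
    unfolding S_def using that ring_module.subspace_0[OF ideal_J_max]
    by (intro CollectI exI[of _ f] exI[of _ 0]) auto
  have idI: "ideal I" using I by (simp add: graded_submodule_def)
  have S_J: "f \<in> S" if "f \<in> J" for f
    unfolding S_def using that ring_module.subspace_0[OF idI]
    by (intro CollectI exI[of _ 0] exI[of _ f]) auto
  \<comment> \<open>An additive operator that preserves both summands preserves the sum; this serves
    scaling, components, permutations and Dunkl operators alike.\<close>
  have op: "T h \<in> S"
    if "h \<in> S" "\<And>f g. T (f + g) = T f + T g" "\<And>f. f \<in> I \<Longrightarrow> T f \<in> I" "\<And>f. f \<in> J \<Longrightarrow> T f \<in> J" for T h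
    using that unfolding S_def by blast
  have "graded_submodule c S"
    unfolding graded_submodule_def
  proof (intro conjI allI impI ballI)
    show "ideal S"
    proof (rule ring_module.subspaceI)
      show "0 \<in> S" by (rule S_I) (rule ring_module.subspace_0[OF idI])
    next
      fix f g assume "f \<in> S" "g \<in> S"
      then obtain f1 f2 g1 g2 where
        "f = f1 + f2" "g = g1 + g2" "f1 \<in> I" "f2 \<in> J" "g1 \<in> I" "g2 \<in> J"
        unfolding S_def by blast
      moreover from this have "f + g = (f1 + g1) + (f2 + g2)"
        by (simp add: algebra_simps)
      ultimately show "f + g \<in> S"
        unfolding S_def using ring_module.subspace_add[OF idI] ring_module.subspace_add[OF ideal_J_max] by blast
    next
      fix h f assume "f \<in> S"
      then show "h * f \<in> S"
        by (rule op) (simp_all add: distrib_left ring_module.subspace_scale idI ideal_J_max)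
    qed
    show "hom_component d f \<in> S" if "f \<in> S" for f d
      using that I by (intro op[of f "hom_component d"])
        (auto simp: hom_component_add hom_component_J_max graded_submodule_def)
    show "permute_vars \<sigma> f \<in> S" if "f \<in> S" "bij \<sigma>" for f and \<sigma> :: "'n \<Rightarrow> 'n"
      using that I by (intro op[of f "permute_vars \<sigma>"])
        (auto simp: permute_vars_add permute_vars_J_max graded_submodule_def)
    show "dunkl c k f \<in> S" if "f \<in> S" for f k
      using that I by (intro op[of f "dunkl c k"])
        (auto simp: dunkl_add dunkl_J_max graded_submodule_def)
  qed
  moreover have "S \<noteq> UNIV"
  proof
    assume "S = UNIV"
    then obtain f g where fg: "1 = f + g" "f \<in> I" "g \<in> J"
      unfolding S_def by blast
    have "hom_component 0 (1 :: ('n, 'a) mpol) = 0"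
      unfolding fg(1) hom_component_add
      using graded_submodule_proper_component[OF I fg(2)]
        graded_submodule_proper_component[OF graded_submodule_J_max J_max_proper fg(3)] by simp
    then show False
      by (simp add: hom_component_0_const)
  qed
  moreover have "J \<subseteq> S" using S_J by blast
  ultimately have "S = J"
    using maximal_graded_submodule_J_max[of c, where 'n = 'n]
    unfolding maximal_graded_submodule_def J by blast
  with S_I show ?thesis by blast
qed

text \<open>Dunkl operators commute with multiplication by such an \<open>f\<close>, so the
  principal ideal of \<open>f\<close> is a graded submodule; it is proper since
  \<open>d > 0\<close>.\<close>

lemma symmetric_constant_in_J_max:
  assumes f: "homogeneous (int d) f" "d > 0"
    and sym: "\<And>\<sigma>. bij \<sigma> \<Longrightarrow> permute_vars \<sigma> f = f"
    and diff: "\<And>k. partial_diff k f = 0"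
  shows "f \<in> J"
proof -
  let ?I = "range (\<lambda>g. g * f)"
  have I: "?I = ideal_generated {f}"
    by (simp add: ring_module.span_singleton)
  have dun: "dunkl c k (g * f) = dunkl c k g * f" for g k
    using dunkl_symmetric_mult[of f k c g] sym diff by (simp add: mult.commute)
  have "graded_submodule c ?I"
    unfolding graded_submodule_def
  proof (intro conjI allI impI ballI)
    show "ideal ?I"
      unfolding I by (rule ring_module.subspace_span)
  next
    fix h e assume "h \<in> ?I"
    then obtain g where "h = f * g" by (auto simp: mult.commute)
    then have "hom_component e h = (if d \<le> e then hom_component (e - d) g else 0) * f"
      by (simp add: hom_component_mult_homogeneous[OF f(1)] mult.commute)
    then show "hom_component e h \<in> ?I" by blast
  qed (auto simp: permute_vars_mult sym dun)
  moreover have "?I \<noteq> UNIV"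
  proof
    assume "?I = UNIV"
    then obtain g where g: "1 = f * g" by (metis UNIV_I imageE mult.commute)
    have "hom_component 0 (1 :: ('n, 'a) mpol) = 0"
      unfolding g hom_component_mult_homogeneous[OF f(1)] using f(2) by simp
    then show False
      by (simp add: hom_component_0_const)
  qed
  ultimately show ?thesis
    using graded_submodule_subset_J_max[of ?I] rangeI[of "\<lambda>g. g * f" 1] by auto
qed

text \<open>
  Closure under multiplication by variables is not required here: it follows when all \<open>x\<^sub>i v\<close> lie in
  \<open>J\<close>, because the commutators of Dunkl operators and variables are combinations of permutations.
  The point is that the degree of \<open>v\<close> is then never exceeded modulo \<open>J\<close>.
\<close>

inductive_set dunkl_closure :: "('n, 'a) mpol \<Rightarrow> ('n, 'a) mpol set"
  for v :: "('n, 'a) mpol" where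
    base: "v \<in> dunkl_closure v"
  | J: "f \<in> J \<Longrightarrow> f \<in> dunkl_closure v"
  | add: "f \<in> dunkl_closure v \<Longrightarrow> g \<in> dunkl_closure v \<Longrightarrow> f + g \<in> dunkl_closure v"
  | const: "f \<in> dunkl_closure v \<Longrightarrow> const a * f \<in> dunkl_closure v"
  | permute: "bij \<sigma> \<Longrightarrow> f \<in> dunkl_closure v \<Longrightarrow> permute_vars \<sigma> f \<in> dunkl_closure v"
  | dunkl: "f \<in> dunkl_closure v \<Longrightarrow> dunkl c k f \<in> dunkl_closure v"

lemma dunkl_closure_sum:
  "(\<And>i. i \<in> A \<Longrightarrow> h i \<in> dunkl_closure v) \<Longrightarrow> sum h A \<in> dunkl_closure v"
  using ring_module.subspace_0[OF ideal_J_max]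
  by (induction A rule: infinite_finite_induct) (auto intro: dunkl_closure.intros)

lemma dunkl_closure_minus: "f \<in> dunkl_closure v \<Longrightarrow> - f \<in> dunkl_closure v"
  using dunkl_closure.const[of f v "- 1"] by (simp add: const_uminus)

lemma dunkl_closure_var_mult:
  assumes socle: "\<And>i. var i * v \<in> J"
  shows "f \<in> dunkl_closure v \<Longrightarrow> var i * f \<in> dunkl_closure v"
proof (induction f arbitrary: i rule: dunkl_closure.induct)
  case (J f)
  then show ?case using ring_module.subspace_scale[OF ideal_J_max] by (blast intro: dunkl_closure.J)
next
  case (const f a)
  then show ?case using dunkl_closure.const[of "var i * f" v a] by (simp add: mult.left_commute)
next
  case (permute \<sigma> f)
  have "var i * permute_vars \<sigma> f = permute_vars \<sigma> (var (inv \<sigma> i) * f)"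
    using \<open>bij \<sigma>\<close> by (simp add: permute_vars_mult permute_vars_var bij_is_surj surj_f_inv_f)
  with permute show ?case by (simp add: dunkl_closure.permute)
next
  case (dunkl f k)
  let ?r = "\<lambda>j. const (if i = k then 1 else if i = j then - 1 else 0) * permute_vars (transpose k j) f"
  \<comment> \<open>The commutation relation is solved for this product: the variable now acts on
    \<open>f\<close> first, where the induction hypothesis applies, and the corrections are
    multiples of permuted copies of \<open>f\<close>.\<close>
  have "var i * dunkl c k f = dunkl c k (var i * f) + - (of_bool (i = k) * f) + const c * (\<Sum>j\<in>UNIV - {k}. ?r j)"
    unfolding dunkl_var_mult by (simp add: algebra_simps)
  also have "\<dots> \<in> dunkl_closure v"
  proof (intro dunkl_closure.add dunkl_closure_minus)
    show "dunkl c k (var i * f) \<in> dunkl_closure v"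
      by (intro dunkl_closure.dunkl dunkl.IH)
    show "of_bool (i = k) * f \<in> dunkl_closure v"
      using dunkl_closure.const[OF dunkl.hyps, of "of_bool (i = k)"] by (cases "i = k") auto
    show "const c * (\<Sum>j\<in>UNIV - {k}. ?r j) \<in> dunkl_closure v"
      using dunkl.hyps by (intro dunkl_closure.const dunkl_closure_sum dunkl_closure.permute) auto
  qed
  finally show ?case .
qed (use assms in \<open>auto simp: distrib_left intro: dunkl_closure.intros\<close>)

text \<open>None of the operations that generate the closure raises degrees, so above degree
  \<open>m\<close> only contributions from \<open>J\<close> survive.\<close>

lemma dunkl_closure_hom_component:
  assumes v: "homogeneous (int m) v"
  shows "f \<in> dunkl_closure v \<Longrightarrow> hom_component d f \<in> dunkl_closure v \<and> (d > m \<longrightarrow> hom_component d f \<in> J)"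
proof (induction f arbitrary: d rule: dunkl_closure.induct)
  case base
  have "0 \<in> J" using ring_module.subspace_0[OF ideal_J_max] .
  then show ?case
    unfolding hom_component_homogeneous[OF v] by (auto intro: dunkl_closure.intros)
next
  case (J f)
  then show ?case by (auto intro: dunkl_closure.intros hom_component_J_max)
next
  case (add f g)
  then show ?case
    by (auto simp: hom_component_add intro: dunkl_closure.intros ring_module.subspace_add[OF ideal_J_max])
next
  case (const f a)
  have "hom_component d (const a * f) = const a * hom_component d f"
    using hom_component_mult_homogeneous[of 0 "const a" d f] by (simp add: homogeneous_const)
  with const show ?case
    by (auto intro: dunkl_closure.intros ring_module.subspace_scale[OF ideal_J_max])
next
  case (permute \<sigma> f)
  then show ?case
    by (auto simp: hom_component_permute_vars intro: dunkl_closure.intros permute_vars_J_max)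
next
  case (dunkl f k)
  then show ?case
    by (auto simp: hom_component_dunkl intro: dunkl_closure.intros dunkl_J_max)
qed

text \<open>Under the socle condition the closure of \<open>v\<close> is a graded submodule that,
  modulo \<open>J\<close>, stops at degree \<open>m\<close>. It therefore misses \<open>w\<close>,
  is proper, and lies in \<open>J\<close>. This is the form in which simplicity of the quotient
  enters.\<close>

lemma socle_J_max:
  assumes v: "homogeneous (int m) v" and socle: "\<And>i. var i * v \<in> J"
    and s: "m < s" "homogeneous (int s) w" "w \<notin> J"
  shows "v \<in> J"
proof -
  let ?W = "dunkl_closure v"
  have mult: "g * f \<in> ?W" if "f \<in> ?W" for f g
    using that
  proof (induction g arbitrary: f rule: mpol_induct)
    case (var i)
    then show ?case using dunkl_closure_var_mult socle by blast
  qed (auto simp: distrib_right mult.assoc intro: dunkl_closure.intros)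
  have "ideal ?W"
    by (rule ring_module.subspaceI)
      (auto intro: mult dunkl_closure.intros ring_module.subspace_0[OF ideal_J_max])
  then have "graded_submodule c ?W"
    using dunkl_closure_hom_component[OF v]
    unfolding graded_submodule_def by (auto intro: dunkl_closure.intros)
  moreover have "w \<notin> ?W"
    using dunkl_closure_hom_component[OF v, of w s] s by (auto simp: homogeneous_iff_hom_component)
  ultimately have "?W \<subseteq> J"
    using graded_submodule_subset_J_max by blast
  then show ?thesis by (auto intro: dunkl_closure.intros)
qed

end

section \<open>Hilbert series\<close>

lemma (in vector_space) span_Int_span_Diff:
  assumes C: "independent C" "finite C" and B: "B \<subseteq> C" and x: "x \<in> span B" "x \<in> span (C - B)"
  shows "x = 0"
proof -
  have fin: "finite B" "finite (C - B)"
    using assms finite_subset by auto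
  obtain r where r: "x = (\<Sum>v\<in>B. r v *s v)"
    using x(1) unfolding span_finite[OF fin(1)] by blast
  obtain r' where r': "x = (\<Sum>v\<in>C - B. r' v *s v)"
    using x(2) unfolding span_finite[OF fin(2)] by blast
  \<comment> \<open>Subtracting the two expansions of \<open>x\<close> gives a linear relation on
    all of \<open>C\<close>, with these coefficients.\<close>
  let ?q = "\<lambda>v. if v \<in> B then r v else - r' v"
  have "(\<Sum>v\<in>C. ?q v *s v) = (\<Sum>v\<in>C - B. ?q v *s v) + (\<Sum>v\<in>B. ?q v *s v)"
    by (rule sum.subset_diff[OF B C(2)])
  also have "\<dots> = - x + x"
    by (rule arg_cong2[where f = plus], subst r', unfold sum_negf[symmetric], rule sum.cong)
      (auto simp: r intro: sum.cong)
  finally have "(\<Sum>v\<in>C. ?q v *s v) = 0" by simp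
  then have "r v = 0" if "v \<in> B" for v
    using independentD[OF C(1) C(2) subset_refl, of ?q v] that B by auto
  then show ?thesis by (simp add: r)
qed

text \<open>In a vanishing combination the part on \<open>B\<close> is the negative of the part on
  \<open>C\<close>, so it lies in both spans. This yields additivity of dimension for direct
  sums.\<close>

lemma (in vector_space) independent_Un:
  assumes B: "independent B" "finite B" and C: "independent C" "finite C"
    and Int: "\<And>x. x \<in> span B \<Longrightarrow> x \<in> span C \<Longrightarrow> x = 0"
  shows "independent (B \<union> C)" and "card (B \<union> C) = card B + card C"
proof -
  have disj: "B \<inter> C = {}"
    using Int B(1) dependent_zero span_base by blast
  then show "card (B \<union> C) = card B + card C"
    using B(2) C(2) by (simp add: card_Un_disjoint)
  show "independent (B \<union> C)"
  proof (rule independent_if_scalars_zero)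
    fix r x assume sum0: "(\<Sum>x\<in>B \<union> C. r x *s x) = 0" and x: "x \<in> B \<union> C"
    have sum: "(\<Sum>x\<in>B. r x *s x) + (\<Sum>x\<in>C. r x *s x) = 0"
      using sum0 disj B(2) C(2) by (simp add: sum.union_disjoint)
    have "(\<Sum>x\<in>B. r x *s x) = - (\<Sum>x\<in>C. r x *s x)"
      using sum by (simp add: eq_neg_iff_add_eq_0)
    moreover have "(\<Sum>x\<in>B. r x *s x) \<in> span B" and "(\<Sum>x\<in>C. r x *s x) \<in> span C"
      by (simp_all add: span_sum span_scale span_base)
    ultimately have "(\<Sum>x\<in>B. r x *s x) = 0"
      using Int span_neg by metis
    with sum have "(\<Sum>x\<in>B. r x *s x) = 0" "(\<Sum>x\<in>C. r x *s x) = 0" by auto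
    then show "r x = 0"
      using x independentD[OF B(1,2) subset_refl, of r x] independentD[OF C subset_refl, of r x] by blast
  qed (use B C in auto)
qed

text \<open>Extending a basis of the smaller set reduces comparisons of dimensions to cardinalities;
  the finite spanning set \<open>F\<close> keeps the bases finite.\<close>

lemma (in vector_space) obtain_nested_bases:
  assumes "A \<subseteq> V" "V \<subseteq> span F" "finite F"
  obtains B C where "B \<subseteq> A" "A \<subseteq> span B" "B \<subseteq> C" "C \<subseteq> V" "V \<subseteq> span C" "independent C" "finite C"
    "dim A = card B" "dim V = card C"
proof -
  obtain B where B: "B \<subseteq> A" "independent B" "A \<subseteq> span B"
    using maximal_independent_subset by blast
  obtain C where C: "B \<subseteq> C" "C \<subseteq> V" "independent C" "V \<subseteq> span C"
    using maximal_independent_subset_extend[OF subset_trans[OF B(1) assms(1)] B(2)] by blast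
  have "finite C"
    using independent_span_bound[OF assms(3) C(3)] C(2) assms(2) by blast
  then show thesis
    using that[of B C] B C basis_card_eq_dim[OF B(1,3,2)] basis_card_eq_dim[OF C(2,4,3)] by auto
qed

section \<open>Dimensions of graded pieces\<close>

interpretation mpol: vector_space "\<lambda>a f. const a * f :: ('n, 'a::field) mpol"
  by unfold_locales (simp_all add: distrib_left distrib_right mult.assoc const_add const_mult)

declare mpol.scale_scale [simp del]

definition hom_part :: "('n::finite, 'a::zero) mpol set \<Rightarrow> nat \<Rightarrow> ('n, 'a) mpol set" where
  "hom_part I d = {f \<in> I. homogeneous (int d) f}"

lemma finite_monomials: "finite {m :: 'n::finite \<Rightarrow>\<^sub>0 nat. mon_degree m = d}"
proof (rule finite_imageD)
  have "Poly_Mapping.lookup ` {m :: 'n \<Rightarrow>\<^sub>0 nat. mon_degree m = d} \<subseteq> (UNIV :: 'n set) \<rightarrow>\<^sub>E {..d}"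
    unfolding mon_degree_def by (auto intro: member_le_sum)
  then show "finite (Poly_Mapping.lookup ` {m :: 'n \<Rightarrow>\<^sub>0 nat. mon_degree m = d})"
    by (rule finite_subset) (simp add: finite_PiE)
qed (auto simp: inj_on_def)

text \<open>The monomials of degree \<open>d\<close> serve for all \<open>I\<close> at once; hence
  the order of the quantifiers.\<close>

lemma hom_part_finite_span:
  "\<exists>F :: ('n::finite, 'a::field) mpol set. finite F \<and> (\<forall>I. hom_part I d \<subseteq> mpol.span F)"
proof (intro exI conjI allI)
  let ?F = "(\<lambda>m. Poly_Mapping.single m 1) ` {m :: 'n \<Rightarrow>\<^sub>0 nat. mon_degree m = d} :: ('n, 'a) mpol set"
  show "finite ?F" by (simp add: finite_monomials)
  show "hom_part I d \<subseteq> mpol.span ?F" for I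
  proof
    fix f :: "('n, 'a) mpol" assume "f \<in> hom_part I d"
    then have f: "mon_degree m = d" if "m \<in> Poly_Mapping.keys f" for m
      using that by (auto simp: hom_part_def homogeneous_def)
    have "(\<Sum>m\<in>Poly_Mapping.keys f. Poly_Mapping.single m (coef f m)) \<in> mpol.span ?F"
    proof (rule mpol.span_sum)
      fix m assume "m \<in> Poly_Mapping.keys f"
      then have "const (coef f m) * Poly_Mapping.single m 1 \<in> mpol.span ?F"
        by (intro mpol.span_scale mpol.span_base) (auto simp: f)
      then show "Poly_Mapping.single m (coef f m) \<in> mpol.span ?F"
        by (simp add: const_def mult_single)
    qed
    then show "f \<in> mpol.span ?F"
      using mpol_sum_singles[of f] by simp
  qed
qed

lemma const_mult_in_ideal: "ideal I \<Longrightarrow> f \<in> I \<Longrightarrow> const a * f \<in> I"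
  by (rule ring_module.subspace_scale)

lemma subspace_hom_part: "ideal I \<Longrightarrow> mpol.subspace (hom_part I d)"
  for I :: "('n::finite, 'a::field) mpol set"
  unfolding hom_part_def
  by (rule mpol.subspaceI)
    (auto intro: homogeneous_add homogeneous_const_mult const_mult_in_ideal
      ring_module.subspace_0 ring_module.subspace_add)

lemma hom_part_eqI:
  fixes I K :: "('n::finite, 'a::field) mpol set"
  assumes "ideal I" "I \<subseteq> K" "dim_over (hom_part I d) = dim_over (hom_part K d)"
  shows "hom_part I d = hom_part K d"
proof
  show sub: "hom_part I d \<subseteq> hom_part K d"
    using assms(2) by (auto simp: hom_part_def)
  obtain F :: "('n, 'a) mpol set" where F: "finite F" "\<forall>I. hom_part I d \<subseteq> mpol.span F"
    using hom_part_finite_span by blast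
  obtain B C where BC: "B \<subseteq> hom_part I d" "hom_part I d \<subseteq> mpol.span B" "B \<subseteq> C" "C \<subseteq> hom_part K d"
      "hom_part K d \<subseteq> mpol.span C" "mpol.independent C" "finite C"
      "dim_over (hom_part I d) = card B" "dim_over (hom_part K d) = card C"
    by (rule mpol.obtain_nested_bases[OF sub F(2)[rule_format] F(1)])
  then have "B = C"
    using assms(3) by (simp add: card_subset_eq)
  with BC show "hom_part K d \<subseteq> hom_part I d"
    using mpol.span_minimal[OF BC(1) subspace_hom_part[OF assms(1)]] by blast
qed

text \<open>The two vectors complete a basis of the piece of \<open>I\<close> to one of the piece of
  \<open>K\<close>.\<close>

lemma two_independent_modulo:
  fixes I K :: "('n::finite, 'a::field) mpol set"
  assumes "I \<subseteq> K" "dim_over (hom_part K d) = dim_over (hom_part I d) + 2"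
  obtains u v where "u \<in> hom_part K d" "v \<in> hom_part K d"
    "\<And>a b. const a * u + const b * v \<in> I \<Longrightarrow> a = 0 \<and> b = 0"
proof -
  have sub: "hom_part I d \<subseteq> hom_part K d"
    using assms(1) by (auto simp: hom_part_def)
  obtain F :: "('n, 'a) mpol set" where F: "finite F" "\<forall>I. hom_part I d \<subseteq> mpol.span F"
    using hom_part_finite_span by blast
  obtain B C where BC: "B \<subseteq> hom_part I d" "hom_part I d \<subseteq> mpol.span B" "B \<subseteq> C" "C \<subseteq> hom_part K d"
      "hom_part K d \<subseteq> mpol.span C" "mpol.independent C" "finite C"
      "dim_over (hom_part I d) = card B" "dim_over (hom_part K d) = card C"
    by (rule mpol.obtain_nested_bases[OF sub F(2)[rule_format] F(1)])
  have "card (C - B) = 2"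
    using assms(2) BC by (simp add: card_Diff_subset finite_subset)
  then obtain u v where uv: "C - B = {u, v}" "u \<noteq> v"
    by (meson card_2_iff)
  show thesis
  proof
    show uvK: "u \<in> hom_part K d" "v \<in> hom_part K d" using uv BC by auto
    fix a b assume I: "const a * u + const b * v \<in> I" (is "?w \<in> I")
    have "?w \<in> hom_part I d"
      using I uvK by (auto simp: hom_part_def homogeneous_add homogeneous_const_mult)
    moreover have "?w \<in> mpol.span (C - B)"
      unfolding uv by (intro mpol.span_add mpol.span_scale mpol.span_base) auto
    ultimately have w0: "?w = 0"
      using mpol.span_Int_span_Diff[OF BC(6,7,3)] BC(2) by blast
    have "mpol.independent {u, v}"
      using mpol.independent_mono[OF BC(6)] uv by (metis Diff_subset)
    then have "(if x = u then a else b) = 0" if "x \<in> {u, v}" for x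
      by (rule mpol.independentD[where u = "\<lambda>x. if x = u then a else b", OF _ _ subset_refl _ that])
        (use w0 uv(2) in auto)
    from this[of u] this[of v] show "a = 0 \<and> b = 0"
      using uv(2) by auto
  qed
qed

text \<open>Multiplication by \<open>f\<close> induces an isomorphism from degree
  \<open>m - d\<close> of the ring modulo \<open>I\<close> onto degree \<open>m\<close> of
  \<open>I'\<close> modulo \<open>I\<close>; regularity gives injectivity. The formula is stated
  with sums to avoid truncated subtraction of dimensions.\<close>

lemma dim_hom_part_regular:
  fixes I I' :: "('n::{finite,linorder}, 'a::field) mpol set"
  assumes I: "ideal I" "\<And>g d. g \<in> I \<Longrightarrow> hom_component d g \<in> I"
    and f: "homogeneous (int d) f" "f \<noteq> 0"
    and regular: "\<And>g. f * g \<in> I \<Longrightarrow> g \<in> I"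
    and I': "I' = {u + f * g | u g. u \<in> I}"
    and m: "d \<le> m"
  shows "dim_over (hom_part I' m) + dim_over (hom_part I (m - d)) =
    dim_over (hom_part I m) + dim_over (hom_part UNIV (m - d) :: ('n, 'a) mpol set)"
proof -
  define e where "e = m - d"
  have me: "int d + int e = int m" using m by (simp add: e_def)
  obtain F :: "('n, 'a) mpol set" where F: "finite F" "\<forall>I. hom_part I e \<subseteq> mpol.span F"
    using hom_part_finite_span by blast
  obtain F' :: "('n, 'a) mpol set" where F': "finite F'" "\<forall>I. hom_part I m \<subseteq> mpol.span F'"
    using hom_part_finite_span by blast
  have sub: "hom_part I e \<subseteq> hom_part UNIV e" by (auto simp: hom_part_def)
  obtain C0 C where C: "C0 \<subseteq> hom_part I e" "hom_part I e \<subseteq> mpol.span C0" "C0 \<subseteq> C"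
      "C \<subseteq> hom_part UNIV e" "hom_part UNIV e \<subseteq> mpol.span C" "mpol.independent C" "finite C"
      "dim_over (hom_part I e) = card C0" "dim_over (hom_part UNIV e :: ('n, 'a) mpol set) = card C"
    by (rule mpol.obtain_nested_bases[OF sub F(2)[rule_format] F(1)])
  obtain B0 B where "B0 \<subseteq> hom_part I m" "hom_part I m \<subseteq> mpol.span B0" "B0 \<subseteq> B"
    and B: "B \<subseteq> hom_part I m" "hom_part I m \<subseteq> mpol.span B" "mpol.independent B" "finite B"
    and "dim_over (hom_part I m) = card B0" and B': "dim_over (hom_part I m) = card B"
    by (rule mpol.obtain_nested_bases[OF subset_refl F'(2)[rule_format] F'(1)])
  \<comment> \<open>The set \<open>C - C0\<close> is a basis of degree \<open>e\<close> modulo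
    \<open>I\<close>; its multiples by \<open>f\<close> complete the basis \<open>B\<close> to a
    basis of degree \<open>m\<close> of \<open>I'\<close>.\<close>
  define D where "D = (\<lambda>x. f * x) ` (C - C0)"
  have inj: "inj_on (\<lambda>x. f * x) A" for A
    using f(2) by (auto simp: inj_on_def)
  have finD: "finite D" using C(7) by (simp add: D_def)
  have indC: "mpol.independent (C - C0)"
    using C(6) mpol.independent_mono by blast
  have indD: "mpol.independent D"
  proof (rule mpol.independent_if_scalars_zero[OF finD])
    fix r x assume r: "(\<Sum>x\<in>D. const (r x) * x) = 0" and "x \<in> D"
    then obtain c where c: "c \<in> C - C0" "x = f * c" by (auto simp: D_def)
    have "(\<Sum>x\<in>D. const (r x) * x) = f * (\<Sum>c\<in>C - C0. const (r (f * c)) * c)"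
      unfolding D_def by (subst sum.reindex[OF inj]) (simp add: sum_distrib_left mult_ac)
    then have "(\<Sum>c\<in>C - C0. const (r (f * c)) * c) = 0"
      using r f(2) by simp
    then show "r x = 0"
      using mpol.independentD[OF indC _ subset_refl, of "\<lambda>c. r (f * c)" c] c C(7) by simp
  qed
  \<comment> \<open>A common element is \<open>f * z\<close> with \<open>z\<close> in the span of
    \<open>C - C0\<close>. Regularity puts \<open>z\<close> into \<open>I\<close>, hence also into
    the span of \<open>C0\<close>, so \<open>z = 0\<close>.\<close>
  have Int: "x = 0" if "x \<in> mpol.span B" "x \<in> mpol.span D" for x
  proof -
    have "x \<in> hom_part I m"
      using that(1) mpol.span_minimal[OF B(1) subspace_hom_part[OF I(1)]] by blast
    moreover have "\<exists>z\<in>mpol.span (C - C0). x = f * z"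
      using that(2)
    proof (induction rule: mpol.span_induct_alt)
      case base
      show ?case by (rule bexI[of _ 0]) (simp_all add: mpol.span_zero)
    next
      case (step a y x)
      then obtain z c where "z \<in> mpol.span (C - C0)" "x = f * z" "y = f * c" "c \<in> C - C0"
        by (auto simp: D_def)
      then have "const a * c + z \<in> mpol.span (C - C0)" "const a * y + x = f * (const a * c + z)"
        by (auto simp: distrib_left mult.left_commute intro: mpol.span_add mpol.span_scale mpol.span_base)
      then show ?case by blast
    qed
    then obtain z where z: "z \<in> mpol.span (C - C0)" "x = f * z" by blast
    ultimately have "z \<in> I"
      using regular by (auto simp: hom_part_def)
    moreover have "homogeneous (int e) z"
    proof -
      have "C - C0 \<subseteq> hom_part UNIV e" using C by blast
      from mpol.span_minimal[OF this subspace_hom_part] z(1) show ?thesis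
        by (auto simp: hom_part_def ring_module.subspace_UNIV)
    qed
    ultimately have "z \<in> mpol.span C0"
      using C(2) by (auto simp: hom_part_def)
    then show "x = 0"
      using mpol.span_Int_span_Diff[OF C(6,7,3) _ z(1)] z(2) by simp
  qed
  note un = mpol.independent_Un[OF B(3,4) indD finD Int]
  have subI: "B \<union> D \<subseteq> hom_part I' m"
  proof
    fix x assume "x \<in> B \<union> D"
    then show "x \<in> hom_part I' m"
    proof
      assume "x \<in> B"
      then have x: "x \<in> I" "homogeneous (int m) x" using B(1) by (auto simp: hom_part_def)
      then show ?thesis
        unfolding hom_part_def I' by (intro CollectI conjI exI[of _ x] exI[of _ 0]) simp_all
    next
      assume "x \<in> D"
      then obtain c where c: "c \<in> C" "x = f * c" by (auto simp: D_def)
      then have "homogeneous (int e) c" using C(4) by (auto simp: hom_part_def)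
      from homogeneous_mult[OF f(1) this] show ?thesis
        unfolding hom_part_def I' using c(2) me ring_module.subspace_0[OF I(1)]
        by (intro CollectI conjI exI[of _ 0] exI[of _ c]) simp_all
    qed
  qed
  have spans: "hom_part I' m \<subseteq> mpol.span (B \<union> D)"
  proof
    fix h assume "h \<in> hom_part I' m"
    then obtain u g where h: "h = u + f * g" "u \<in> I" "homogeneous (int m) h"
      unfolding hom_part_def I' by blast
    have "h = hom_component m h" using h(3) homogeneous_iff_hom_component[of m h] by simp
    also have "\<dots> = hom_component m u + f * hom_component e g"
      unfolding h(1) hom_component_add hom_component_mult_homogeneous[OF f(1)] using m by (simp add: e_def)
    also have "\<dots> \<in> mpol.span (B \<union> D)"
    proof (rule mpol.span_add)
      have spB: "x \<in> mpol.span (B \<union> D)" if "x \<in> I" "homogeneous (int m) x" for x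
        using that B(2) mpol.span_mono[of B "B \<union> D"] by (auto simp: hom_part_def)
      show "hom_component m u \<in> mpol.span (B \<union> D)"
        by (rule spB) (simp_all add: I(2) h(2))
      have "hom_component e g \<in> mpol.span C"
        using C(5) by (auto simp: hom_part_def)
      then show "f * hom_component e g \<in> mpol.span (B \<union> D)"
      proof (induction rule: mpol.span_induct_alt)
        case base
        show ?case by (simp add: mpol.span_zero)
      next
        case (step a c x)
        have "f * c \<in> mpol.span (B \<union> D)"
        \<comment> \<open>Elements of \<open>C0\<close> lie in \<open>I\<close>, so their multiples
          by \<open>f\<close> are covered by \<open>B\<close>.\<close>
        proof (cases "c \<in> C0")
          case True
          then have "c \<in> I" "homogeneous (int e) c" using C(1) by (auto simp: hom_part_def)
          then show ?thesis
            using homogeneous_mult[OF f(1), of "int e" c] me ring_module.subspace_scale[OF I(1)]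
            by (intro spB) auto
        next
          case False
          with step show ?thesis by (intro mpol.span_base) (auto simp: D_def)
        qed
        then have "const a * (f * c) + f * x \<in> mpol.span (B \<union> D)"
          using step by (intro mpol.span_add mpol.span_scale)
        moreover have "f * (const a * c + x) = const a * (f * c) + f * x"
          by (simp add: distrib_left mult.left_commute)
        ultimately show ?case by simp
      qed
    qed
    finally show "h \<in> mpol.span (B \<union> D)" .
  qed
  have "dim_over (hom_part I' m) = card B + card D"
    using mpol.basis_card_eq_dim[OF subI spans un(1)] un(2) by simp
  moreover have "card D = card C - card C0"
    unfolding D_def using C(3,7) by (simp add: card_image[OF inj] card_Diff_subset finite_subset)
  moreover have "card C0 \<le> card C"
    using C(3,7) by (simp add: card_mono)
  ultimately show ?thesis
    using B' C(8,9) unfolding e_def by simp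
qed

lemma ideal_generated_insert:
  "ideal_generated (insert f S) = {u + f * g | u g. u \<in> ideal_generated S}"
proof (intro set_eqI iffI)
  fix x assume "x \<in> ideal_generated (insert f S)"
  then obtain k where "x - k * f \<in> ideal_generated S"
    unfolding ring_module.span_breakdown_eq by blast
  then show "x \<in> {u + f * g | u g. u \<in> ideal_generated S}"
    by (intro CollectI exI[of _ "x - k * f"] exI[of _ k]) (simp add: mult.commute)
next
  fix x assume "x \<in> {u + f * g | u g. u \<in> ideal_generated S}"
  then obtain u g where "x = u + f * g" "u \<in> ideal_generated S" by blast
  then show "x \<in> ideal_generated (insert f S)"
    unfolding ring_module.span_breakdown_eq by (intro exI[of _ g]) (simp add: mult.commute)
qed

lemma hom_component_ideal_generated:
  assumes S: "\<And>f. f \<in> S \<Longrightarrow> \<exists>d. homogeneous (int d) f" and g: "g \<in> ideal_generated S"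
  shows "hom_component d g \<in> ideal_generated S"
  using g
proof (induction arbitrary: d rule: ring_module.span_induct_alt)
  case base
  show ?case by (simp add: hom_component_zero ring_module.span_zero)
next
  case (step c x y)
  obtain e where "homogeneous (int e) x" using S step by blast
  then have "hom_component d (c * x + y) = (if e \<le> d then hom_component (d - e) c else 0) * x + hom_component d y"
    using hom_component_mult_homogeneous[of e x d c] by (simp add: hom_component_add mult.commute)
  then show ?case
    using step by (simp add: ring_module.span_add ring_module.span_scale ring_module.span_base)
qed

text \<open>The power series behind \<open>quotient_hilbert_series\<close>, with coefficients that
  can be compared degree by degree. For \<open>{0}\<close> it is the series of the polynomial
  ring.\<close>

definition hilbert :: "('n::finite, 'a::field) mpol set \<Rightarrow> rat fps" where
  "hilbert I = Abs_fps (\<lambda>d. of_nat (dim_over (hom_part UNIV d :: ('n, 'a) mpol set)) - of_nat (dim_over (hom_part I d)))"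

lemma quotient_hilbert_series_eq: "quotient_hilbert_series I = fps_to_fls (hilbert I)"
  by (simp add: quotient_hilbert_series_def hilbert_def hom_part_def)

lemma hilbert_nth_eq_iff: 
  fixes I K :: "('n::finite, 'a::field) mpol set"
  shows "fps_nth (hilbert I) d = fps_nth (hilbert K) d \<longleftrightarrow> dim_over (hom_part I d) = dim_over (hom_part K d)"
  by (simp add: hilbert_def)

text \<open>The generating function form of \<open>dim_hom_part_regular\<close>; below degree
  \<open>d\<close> the multiples of \<open>f\<close> contribute nothing.\<close>

lemma hilbert_regular:
  fixes I :: "('n::{finite,linorder}, 'a::field) mpol set"
  assumes I: "ideal I" "\<And>g d. g \<in> I \<Longrightarrow> hom_component d g \<in> I"
    and f: "homogeneous (int d) f" "f \<noteq> 0"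
    and regular: "\<And>g. f * g \<in> I \<Longrightarrow> g \<in> I"
  shows "hilbert {u + f * g | u g. u \<in> I} = (1 - fps_X ^ d) * hilbert I" (is "hilbert ?I' = _")
proof (rule fps_ext)
  fix m
  let ?H = "hilbert I" and ?H' = "hilbert ?I'"
  have "fps_nth ?H' m = fps_nth ?H m - (if m < d then 0 else fps_nth ?H (m - d))"
  proof (cases "m < d")
    case True
    have "hom_part ?I' m = hom_part I m"
    proof (intro set_eqI iffI)
      fix h assume "h \<in> hom_part ?I' m"
      then obtain u g where h: "h = u + f * g" "u \<in> I" "homogeneous (int m) h"
        unfolding hom_part_def by blast
      have "h = hom_component m h" using h(3) homogeneous_iff_hom_component[of m h] by simp
      also have "\<dots> = hom_component m u"
        unfolding h(1) hom_component_add hom_component_mult_homogeneous[OF f(1)] using True by simp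
      also have "\<dots> \<in> I" by (rule I(2)) (fact h(2))
      finally show "h \<in> hom_part I m"
        using h(3) by (simp add: hom_part_def)
    next
      fix h assume "h \<in> hom_part I m"
      then show "h \<in> hom_part ?I' m"
        unfolding hom_part_def by (intro CollectI conjI exI[of _ h] exI[of _ 0]) simp_all
    qed
    with True show ?thesis by (simp add: hilbert_def)
  next
    case False
    then have "rat_of_nat (dim_over (hom_part ?I' m)) + of_nat (dim_over (hom_part I (m - d))) =
        of_nat (dim_over (hom_part I m)) + of_nat (dim_over (hom_part UNIV (m - d) :: ('n, 'a) mpol set))"
      using dim_hom_part_regular[OF I f regular refl, of m]
      unfolding of_nat_add[symmetric] by simp
    with False show ?thesis by (simp add: hilbert_def)
  qed
  then show "fps_nth ?H' m = fps_nth ((1 - fps_X ^ d) * ?H) m"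
    by (simp add: left_diff_distrib fps_X_power_mult_nth)
qed

text \<open>Induction from the right end: the last element is regular modulo the ideal of its
  predecessors and contributes one factor.\<close>

lemma hilbert_regular_sequence:
  fixes fs :: "('n::{finite,linorder}, 'a::field) mpol list"
  assumes "\<And>i g. i < length fs \<Longrightarrow> fs ! i * g \<in> ideal_generated (set (take i fs)) \<Longrightarrow>
      g \<in> ideal_generated (set (take i fs))"
    and "list_all2 (\<lambda>d f. f \<noteq> 0 \<and> homogeneous (int d) f) ds fs"
  shows "hilbert (ideal_generated (set fs)) = (\<Prod>d\<leftarrow>ds. 1 - fps_X ^ d) * hilbert {0 :: ('n, 'a) mpol}"
  using assms
proof (induction fs arbitrary: ds rule: rev_induct)
  case Nil
  then show ?case by (simp add: ring_module.span_empty)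
next
  case (snoc f fs)
  obtain d ds' where ds: "ds = ds' @ [d]" "list_all2 (\<lambda>d f. f \<noteq> 0 \<and> homogeneous (int d) f) ds' fs"
    and f: "f \<noteq> 0" "homogeneous (int d) f"
    using snoc.prems(2) by (auto simp: list_all2_append2 list_all2_Cons2)
  let ?I = "ideal_generated (set fs)"
  have "\<exists>d. homogeneous (int d) g" if "g \<in> set fs" for g
    using ds(2) that by (auto simp: list_all2_conv_all_nth in_set_conv_nth)
  then have hom: "hom_component d g \<in> ?I" if "g \<in> ?I" for g d
    using that by (rule hom_component_ideal_generated)
  have "hilbert ?I = (\<Prod>d\<leftarrow>ds'. 1 - fps_X ^ d) * hilbert {0 :: ('n, 'a) mpol}"
  proof (rule snoc.IH[OF _ ds(2)])
    show "g \<in> ideal_generated (set (take i fs))"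
      if "i < length fs" "fs ! i * g \<in> ideal_generated (set (take i fs))" for i g
      using snoc.prems(1)[of i g] that by (simp add: nth_append)
  qed
  moreover have "g \<in> ?I" if "f * g \<in> ?I" for g
    using snoc.prems(1)[of "length fs" g] that by simp
  ultimately show ?case
    using hilbert_regular[OF ring_module.subspace_span hom f(2,1)]
    by (simp add: ideal_generated_insert ds(1) mult.assoc mult.left_commute)
qed

lemma hom_part_0_proper:
  fixes I :: "('n::finite, 'a::field) mpol set"
  assumes "ideal I" "I \<noteq> UNIV"
  shows "hom_part I 0 = {0}"
proof -
  have "f = 0" if f: "f \<in> I" "homogeneous 0 f" for f
  proof (rule ccontr)
    assume "f \<noteq> 0"
    define a where "a = coef f 0"
    have a: "f = const a" using homogeneous_degree_0[OF f(2)] by (simp add: a_def)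
    with \<open>f \<noteq> 0\<close> have "const (inverse a) * f = 1"
      by (simp add: const_mult[symmetric])
    moreover have "const (inverse a) * f \<in> I"
      by (rule ring_module.subspace_scale[OF assms(1) f(1)])
    ultimately show False
      using one_in_ideal[OF assms(1)] assms(2) by simp
  qed
  then show ?thesis
    using ring_module.subspace_0[OF assms(1)] by (auto simp: hom_part_def)
qed

lemma dim_hom_part_UNIV_0: "dim_over (hom_part UNIV 0 :: ('n::finite, 'a::field) mpol set) = 1"
proof -
  have "hom_part UNIV 0 \<subseteq> mpol.span {1 :: ('n, 'a) mpol}"
  proof
    fix f :: "('n, 'a) mpol" assume "f \<in> hom_part UNIV 0"
    then have "f = const (coef f 0) * 1"
      using homogeneous_degree_0[of f] by (simp add: hom_part_def)
    also have "\<dots> \<in> mpol.span {1}"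
      by (intro mpol.span_scale mpol.span_base) simp
    finally show "f \<in> mpol.span {1}" .
  qed
  from mpol.basis_card_eq_dim[OF _ this] show ?thesis
    by (simp add: hom_part_def homogeneous_1)
qed

lemma hilbert_nth_0:
  assumes "ideal I" "I \<noteq> UNIV"
  shows "fps_nth (hilbert I) 0 = 1"
  using mpol.basis_card_eq_dim[of "{}" "{0}"]
  by (simp add: hilbert_def hom_part_0_proper[OF assms] dim_hom_part_UNIV_0 mpol.independent_empty
      mpol.span_empty)

text \<open>Modulo \<open>I\<close> every polynomial is congruent to a constant; taking components
  puts all forms of positive degree into \<open>I\<close>.\<close>

lemma hilbert_maximal_ideal:
  fixes I :: "('n::finite, 'a::field) mpol set"
  assumes "ideal I" "I \<noteq> UNIV" "\<And>g d. g \<in> I \<Longrightarrow> hom_component d g \<in> I" "\<And>i. var i \<in> I"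
  shows "hilbert I = 1"
proof (rule fps_ext)
  fix d
  show "fps_nth (hilbert I) d = fps_nth 1 d"
  proof (cases "d = 0")
    case False
    have "hom_part UNIV d \<subseteq> I"
    proof
      fix f :: "('n, 'a) mpol" assume f: "f \<in> hom_part UNIV d"
      have "\<exists>a. f - const a \<in> I"
      proof (induction f rule: mpol_induct)
        case (const a)
        show ?case using ring_module.subspace_0[OF assms(1)] by (intro exI[of _ a]) simp
      next
        case (var i)
        show ?case using assms(4) by (intro exI[of _ 0]) simp
      next
        case (add f g)
        then obtain a b where "f - const a \<in> I" "g - const b \<in> I" by blast
        from ring_module.subspace_add[OF assms(1) this] show ?case
          by (intro exI[of _ "a + b"]) (simp add: const_add algebra_simps)
      next
        case (mult f g)
        then obtain a b where ab: "f - const a \<in> I" "g - const b \<in> I" by blast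
        have "f * g - const (a * b) = g * (f - const a) + const a * (g - const b)"
          by (simp add: const_mult algebra_simps)
        with ab show ?case
          using ring_module.subspace_add[OF assms(1)] ring_module.subspace_scale[OF assms(1)] by metis
      qed
      then obtain a where "f - const a \<in> I" by blast
      from assms(3)[OF this, of d] show "f \<in> I"
        using f False hom_component_homogeneous[of 0 "const a :: ('n, 'a) mpol" d] homogeneous_iff_hom_component[of d f]
        by (simp add: hom_part_def hom_component_diff homogeneous_const)
    qed
    then have "hom_part UNIV d = hom_part I d"
      by (auto simp: hom_part_def)
    with False show ?thesis by (simp add: hilbert_def)
  qed (simp add: hilbert_nth_0 assms)
qed

section \<open>Binary forms\<close>

text \<open>A nonzero element \<open>g\<close> of least degree in the ideal of \<open>p\<close> and
  \<open>q\<close> divides both, by division with remainder. Cancelling \<open>g\<close> in its own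
  representation gives the Bezout identity.\<close>

lemma poly_common_factor:
  fixes p q :: "'a::field poly"
  assumes "p \<noteq> 0 \<or> q \<noteq> 0"
  obtains g p' q' u v where "g \<noteq> 0" "p = g * p'" "q = g * q'" "u * p' + v * q' = 1"
proof -
  define I where "I = {u * p + v * q | u v. True}"
  have mem: "p \<in> I" "q \<in> I"
    unfolding I_def by (auto intro: exI[of _ 1] exI[of _ 0])
  have lin: "x - h * y \<in> I" if xy: "x \<in> I" "y \<in> I" for x y h
  proof -
    obtain u v u' v' where "x = u * p + v * q" "y = u' * p + v' * q"
      using xy unfolding I_def by blast
    then have "x - h * y = (u - h * u') * p + (v - h * v') * q"
      by (simp add: algebra_simps)
    then show ?thesis unfolding I_def by blast
  qed
  obtain g where g: "g \<in> I - {0}" and min: "\<And>x. x \<in> I - {0} \<Longrightarrow> degree g \<le> degree x"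
    using assms mem ex_has_least_nat[of "\<lambda>x. x \<in> I - {0}" _ degree] by (metis DiffI empty_iff insert_iff)
  have "g dvd x" if "x \<in> I" for x
  proof -
    have "x mod g = x - (x div g) * g"
      by (simp add: minus_div_mult_eq_mod)
    then have "x mod g \<in> I" using lin that g by simp
    then have "x mod g = 0"
      using min[of "x mod g"] degree_mod_less[of g x] g by fastforce
    then show ?thesis by (simp add: dvd_eq_mod_eq_0)
  qed
  then obtain p' q' where pq: "p = g * p'" "q = g * q'"
    using mem by (meson dvdE)
  obtain u v where "g = u * p + v * q" using g unfolding I_def by blast
  then have "g * (u * p' + v * q') = g * 1"
    using pq by (simp add: algebra_simps)
  then have "u * p' + v * q' = 1"
    using g by (metis DiffD2 insertI1 mult_left_cancel)
  with g pq show thesis by (intro that[of g p' q' u v]) auto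
qed

text \<open>
  In homogeneous terms: two coprime binary forms of degree \<open>r\<close> generate all forms of degree at least
  \<open>2 r - 1\<close>. The equation \<open>degree h1 = r\<close> excludes a common zero at infinity.
\<close>

lemma bezout_degree_bound:
  fixes h1 h2 :: "'a::field poly"
  assumes bezout: "u * h1 + v * h2 = 1" and "h1 \<noteq> 0" "degree h1 = r" "degree h2 \<le> r"
    and n: "2 * r - 1 \<le> n" "degree f \<le> n"
  obtains w1 w2 where "f = w1 * h1 + w2 * h2" "degree w1 + r \<le> n" "degree w2 + r \<le> n"
proof
  \<comment> \<open>The cofactor of \<open>h2\<close> is reduced modulo \<open>h1\<close> to bound
    its degree; the quotient moves to the cofactor of \<open>h1\<close>.\<close>
  define w2 where "w2 = (f * v) mod h1"
  define w1 where "w1 = f * u + ((f * v) div h1) * h2"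
  show f: "f = w1 * h1 + w2 * h2"
  proof -
    have "w1 * h1 + w2 * h2 = f * u * h1 + ((f * v) div h1 * h1 + (f * v) mod h1) * h2"
      by (simp only: w1_def w2_def algebra_simps)
    also have "\<dots> = f * (u * h1 + v * h2)"
      by (simp only: div_mult_mod_eq) (simp add: algebra_simps)
    finally show ?thesis by (simp add: bezout)
  qed
  have w2: "w2 = 0 \<or> degree w2 < r"
    using degree_mod_less[of h1 "f * v"] assms by (auto simp: w2_def)
  show w2n: "degree w2 + r \<le> n"
  proof (cases "w2 = 0")
    case True
    \<comment> \<open>For \<open>r = 0\<close>, where \<open>2 * r - 1\<close> is truncated, this is
      trivial; otherwise \<open>r \<le> 2 * r - 1\<close>.\<close>
    have "r \<le> n"
    proof (cases r)
      case (Suc k)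
      with n(1) show ?thesis by simp
    qed simp
    with True show ?thesis by simp
  qed (use w2 n in linarith)
  show "degree w1 + r \<le> n"
  proof (cases "w1 = 0")
    case True
    then show ?thesis using w2n by simp
  next
    case False
    have "degree (w2 * h2) \<le> n"
      using degree_mult_le[of w2 h2] w2n assms(4) by linarith
    \<comment> \<open>The degree of \<open>w1\<close> is read off from this product, since
      \<open>h1\<close> has degree exactly \<open>r\<close>.\<close>
    moreover have "w1 * h1 = f - w2 * h2"
      using f by simp
    ultimately have "degree (w1 * h1) \<le> n"
      using n(2) by (simp add: degree_diff_le)
    then show ?thesis
      using False assms by (simp add: degree_mult_eq)
  qed
qed

lemma const_numeral [simp]: "const (numeral w) = numeral w"
  by (simp add: const_def)

text \<open>The type \<open>3\<close> consists of residues modulo 3, in which the index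
  \<open>3\<close> is \<open>0\<close>.\<close>

lemma UNIV_3: "(UNIV :: 3 set) = {1, 2, 3}"
proof -
  have "x \<in> {1, 2, 3}" for x :: 3
  proof (induct x)
    case (of_int z)
    then have "z = 0 \<or> z = 1 \<or> z = 2" by auto
    then show ?case by auto
  qed
  then show ?thesis by auto
qed

text \<open>Coordinates that separate the symmetric linear form from the differences of variables,
  which are invariant under simultaneous translation.\<close>

definition mpol_y :: "(3, 'a::field) mpol" where "mpol_y = (\<Sum>i\<in>UNIV. var i)"
definition mpol_a :: "(3, 'a::field) mpol" where "mpol_a = var 1 - var 2"
definition mpol_b :: "(3, 'a::field) mpol" where "mpol_b = var 1 - var 3"

lemma homogeneous_yab: "homogeneous 1 mpol_y" "homogeneous 1 mpol_a" "homogeneous 1 mpol_b"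
  by (simp_all add: mpol_y_def mpol_a_def mpol_b_def homogeneous_sum homogeneous_diff homogeneous_var)

lemma mpol_y_eq: "mpol_y = var 1 + var 2 + var 3"
proof -
  have "(1 :: 3) \<notin> {2, 3}" "(2 :: 3) \<notin> {3}" by simp_all
  then show ?thesis
    unfolding mpol_y_def UNIV_3
    by (simp only: sum.insert finite.intros sum.empty empty_iff not_False_eq_True add_0_right add.assoc)
qed

text \<open>The homogenization of \<open>P\<close> as a form of degree \<open>m\<close> in \<open>a, b\<close>; it drops terms if \<open>degree P > m\<close>.\<close>

definition binary_form :: "nat \<Rightarrow> 'a poly \<Rightarrow> (3, 'a::field) mpol" where
  "binary_form m P = (\<Sum>i\<le>m. const (poly.coeff P i) * mpol_a ^ i * mpol_b ^ (m - i))"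

lemma binary_form_0 [simp]: "binary_form m 0 = 0"
  by (simp add: binary_form_def)

lemma binary_form_add: "binary_form m (P + Q) = binary_form m P + binary_form m Q"
  by (simp add: binary_form_def const_add distrib_right sum.distrib)

lemma binary_form_smult: "binary_form m (smult c P) = const c * binary_form m P"
  by (simp add: binary_form_def const_mult sum_distrib_left mult.assoc)

lemma binary_form_sum: "binary_form m (sum h A) = (\<Sum>a\<in>A. binary_form m (h a))"
  by (induction A rule: infinite_finite_induct) (simp_all add: binary_form_add)

lemma binary_form_monom:
  assumes "i \<le> m"
  shows "binary_form m (monom c i) = const c * mpol_a ^ i * mpol_b ^ (m - i)"
proof -
  have "binary_form m (monom c i) = (\<Sum>j\<le>m. if j = i then const c * mpol_a ^ i * mpol_b ^ (m - i) else 0)"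
    unfolding binary_form_def by (rule sum.cong) auto
  with assms show ?thesis by simp
qed

lemma poly_eq_sum_monom: "degree P \<le> m \<Longrightarrow> P = (\<Sum>i\<le>m. monom (poly.coeff P i) i)"
  by (rule poly_eqI) (auto simp: coeff_sum coeff_monom intro: coeff_eq_0)

text \<open>Under the degree bounds no term is dropped, and bilinearity reduces the identity to
  monomials.\<close>

lemma binary_form_mult:
  assumes "degree P \<le> m" "degree Q \<le> n"
  shows "binary_form m P * binary_form n Q = binary_form (m + n) (P * Q)"
proof -
  have *: "binary_form m (monom c i) * binary_form n (monom d j) = binary_form (m + n) (monom c i * monom d j)"
    if "i \<le> m" "j \<le> n" for c d :: 'a and i j
  proof -
    have "m + n - (i + j) = (m - i) + (n - j)" and ij: "i + j \<le> m + n"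
      using that by simp_all
    then have "binary_form (m + n) (monom c i * monom d j) =
        const (c * d) * mpol_a ^ (i + j) * mpol_b ^ ((m - i) + (n - j))"
      unfolding mult_monom by (simp only: binary_form_monom)
    then show ?thesis
      unfolding binary_form_monom[OF that(1)] binary_form_monom[OF that(2)]
      by (simp only: power_add const_mult mult_ac)
  qed
  let ?P = "\<Sum>i\<le>m. monom (poly.coeff P i) i" and ?Q = "\<Sum>j\<le>n. monom (poly.coeff Q j) j"
  have "binary_form m ?P * binary_form n ?Q = binary_form (m + n) (?P * ?Q)"
    unfolding sum_product binary_form_sum by (intro sum.cong refl *) auto
  then show ?thesis
    by (simp only: poly_eq_sum_monom[OF assms(1), symmetric] poly_eq_sum_monom[OF assms(2), symmetric])
qed

lemma homogeneous_binary_form: "homogeneous (int m) (binary_form m P)"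
  unfolding binary_form_def
proof (rule homogeneous_sum)
  fix i assume "i \<in> {..m}"
  then have "int i + int (m - i) = int m" by auto
  then show "homogeneous (int m) (const (poly.coeff P i) * mpol_a ^ i * mpol_b ^ (m - i))"
    using homogeneous_mult[OF homogeneous_const_mult[OF homogeneous_power[OF homogeneous_yab(2), of i]]
        homogeneous_power[OF homogeneous_yab(3), of "m - i"], of "poly.coeff P i"] by simp
qed

text \<open>Sends \<open>a\<close> to \<open>x\<^sub>1\<close> and \<open>b\<close> to \<open>1\<close>.\<close>

definition dehomogenize :: "(3, 'a::field) mpol \<Rightarrow> (3, 'a) mpol" where
  "dehomogenize = subst (\<lambda>i. if i = 1 then 0 else if i = 2 then - var 1 else - 1)"

lemma const_mult_var_power: "const c * var i ^ n = Poly_Mapping.single (Poly_Mapping.single i n) c"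
  by (simp add: var_power const_def mult_single)

lemma dehomogenize_binary_form:
  "dehomogenize (binary_form m P) = (\<Sum>i\<le>m. Poly_Mapping.single (Poly_Mapping.single 1 i) (poly.coeff P i))"
proof -
  have "dehomogenize mpol_a = (var 1 :: (3, 'a) mpol)" "dehomogenize mpol_b = (1 :: (3, 'a) mpol)"
    by (simp_all add: dehomogenize_def mpol_a_def mpol_b_def subst_diff)
  then show ?thesis
    unfolding binary_form_def
    by (simp add: dehomogenize_def subst_sum subst_mult subst_power const_mult_var_power)
qed

text \<open>Dehomogenization recovers the coefficients up to index \<open>m\<close>, and the degree
  bound leaves no others.\<close>

lemma binary_form_eq_0:
  assumes "degree P \<le> m" "binary_form m P = 0"
  shows "P = 0"
proof (rule poly_eqI)
  fix i
  have 0: "(\<Sum>i\<le>m. Poly_Mapping.single (Poly_Mapping.single (1::3) i) (poly.coeff P i)) = 0"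
    using dehomogenize_binary_form[of m P] assms(2) by (simp add: dehomogenize_def)
  have inj: "Poly_Mapping.single (1::3) j = Poly_Mapping.single 1 i \<longleftrightarrow> j = i" for j i :: nat
    by (metis lookup_single_eq)
  have "poly.coeff P i = 0" if "i \<le> m"
    using arg_cong[OF 0, of "\<lambda>f. coef f (Poly_Mapping.single 1 i)"] that
    by (simp add: lookup_sum lookup_single when_def inj)
  then show "poly.coeff P i = poly.coeff 0 i"
    using assms(1) by (cases "i \<le> m") (auto simp: coeff_eq_0)
qed

context
  assumes three: "(3 :: 'a::field) \<noteq> 0"
begin

text \<open>The projection onto \<open>K[a, b]\<close> along the ideal \<open>(y)\<close>.\<close>

definition y_retract :: "(3, 'a) mpol \<Rightarrow> (3, 'a) mpol" where
  "y_retract = subst (\<lambda>i. var i - const (1 / 3) * mpol_y)"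

lemma y_retract_mult: "y_retract (f * g) = y_retract f * y_retract g"
  and y_retract_add: "y_retract (f + g) = y_retract f + y_retract g"
  and y_retract_const: "y_retract (const c) = const c"
  and y_retract_power: "y_retract (f ^ n) = y_retract f ^ n"
  by (simp_all add: y_retract_def subst_mult subst_add subst_diff subst_power)

lemma y_retract_y [simp]: "y_retract mpol_y = 0"
proof -
  have "y_retract mpol_y = mpol_y - const (1 / 3) * (3 * mpol_y)"
    unfolding mpol_y_def[where 'a = 'a] by (simp add: y_retract_def subst_sum sum_subtractf mpol_y_def)
  also have "const (1 / 3) * (3 * mpol_y) = const (1 / 3) * const 3 * (mpol_y :: (3, 'a) mpol)"
    by (simp add: mult.assoc)
  also have "\<dots> = mpol_y"
    unfolding const_mult[symmetric] using three by simp
  finally show ?thesis by simp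
qed

lemma y_retract_ab [simp]: "y_retract mpol_a = mpol_a" "y_retract mpol_b = mpol_b"
  by (simp_all add: y_retract_def mpol_a_def mpol_b_def subst_diff)

lemma y_retract_binary_form [simp]: "y_retract (binary_form m P) = binary_form m P"
proof -
  have "y_retract (sum h A) = (\<Sum>a\<in>A. y_retract (h a))" for h :: "nat \<Rightarrow> _" and A
    by (simp add: y_retract_def subst_sum)
  then show ?thesis
    by (simp add: binary_form_def y_retract_mult y_retract_power y_retract_const)
qed

lemma y_dvd_diff_retract: "mpol_y dvd f - y_retract f"
  unfolding y_retract_def by (rule dvd_diff_subst) simp

lemma y_dvd_iff: "mpol_y dvd f \<longleftrightarrow> y_retract f = 0"
proof
  assume "mpol_y dvd f"
  then show "y_retract f = 0" by (auto simp: y_retract_mult elim!: dvdE)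
next
  assume "y_retract f = 0"
  then show "mpol_y dvd f" using y_dvd_diff_retract[of f] by simp
qed

text \<open>\<open>y_retract\<close> is a homomorphism into a domain whose kernel is the ideal of
  \<open>mpol_y\<close>.\<close>

lemma y_prime: "mpol_y dvd f * g \<Longrightarrow> mpol_y dvd f \<or> mpol_y dvd g"
  for f g :: "(3, 'a) mpol"
  by (simp add: y_dvd_iff y_retract_mult)

text \<open>The degree bound on the witness is what \<open>binary_form_mult\<close> and
  \<open>binary_form_eq_0\<close> ask for.\<close>

definition is_binary_form :: "nat \<Rightarrow> (3, 'a) mpol \<Rightarrow> bool" where
  "is_binary_form m f \<longleftrightarrow> (\<exists>P. degree P \<le> m \<and> f = binary_form m P)"

lemma is_binary_form_mult: "is_binary_form m f \<Longrightarrow> is_binary_form n g \<Longrightarrow> is_binary_form (m + n) (f * g)"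
  unfolding is_binary_form_def using binary_form_mult[of _ m _ n]
  by (blast intro: order_trans[OF degree_mult_le add_mono])

lemma is_binary_form_add: "is_binary_form m f \<Longrightarrow> is_binary_form m g \<Longrightarrow> is_binary_form m (f + g)"
  unfolding is_binary_form_def by (blast intro: binary_form_add[symmetric] degree_add_le)

lemma is_binary_form_0: "is_binary_form m 0"
  unfolding is_binary_form_def by (rule exI[of _ 0]) simp

lemma is_binary_form_const: "is_binary_form 0 (const c)"
  unfolding is_binary_form_def by (rule exI[of _ "[:c:]"]) (simp add: binary_form_def)

lemma is_binary_form_power: "is_binary_form m f \<Longrightarrow> is_binary_form (n * m) (f ^ n)"
proof (induction n)
  case (Suc n)
  then show ?case using is_binary_form_mult[of m f "n * m" "f ^ n"] by simp
qed (use is_binary_form_const[of 1] in simp)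

lemma is_binary_form_const_mult: "is_binary_form m f \<Longrightarrow> is_binary_form m (const c * f)"
  using is_binary_form_mult[OF is_binary_form_const] by fastforce

lemma is_binary_form_ab: "is_binary_form 1 mpol_a" "is_binary_form 1 mpol_b"
  unfolding is_binary_form_def
  by (rule exI[of _ "[:0, 1:]"], simp add: binary_form_def) (rule exI[of _ "[:1:]"], simp add: binary_form_def)

lemma is_binary_form_y_retract_var: "is_binary_form 1 (y_retract (var i))"
proof -
  have third: "const (1 / 3) * 3 = (1 :: (3, 'a) mpol)"
  proof -
    have "const (1 / 3) * 3 = (const (1 / 3 * 3) :: (3, 'a) mpol)"
      unfolding const_mult by simp
    then show ?thesis using three by simp
  qed
  \<comment> \<open>From \<open>3 * var 1 = mpol_y + mpol_a + mpol_b\<close>.\<close>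
  have 1: "y_retract (var 1) = const (1 / 3) * (mpol_a + mpol_b)"
  proof -
    have "y_retract (var 1) = const (1 / 3) * 3 * var 1 - const (1 / 3) * mpol_y"
      by (simp add: y_retract_def third)
    also have "\<dots> = const (1 / 3) * (3 * var 1 - mpol_y)"
      by (simp add: right_diff_distrib mult.assoc)
    also have "3 * var 1 - mpol_y = mpol_a + (mpol_b :: (3, 'a) mpol)"
      by (simp add: mpol_y_eq mpol_a_def mpol_b_def)
    finally show ?thesis .
  qed
  have 2: "y_retract (var 2) = y_retract (var 1) + const (- 1) * mpol_a"
    and 3: "y_retract (var 3) = y_retract (var 1) + const (- 1) * mpol_b"
    by (simp_all add: y_retract_def mpol_a_def mpol_b_def const_uminus)
  have "is_binary_form 1 (y_retract (var 1))"
    unfolding 1 by (intro is_binary_form_add is_binary_form_const_mult is_binary_form_ab)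
  moreover from this have "is_binary_form 1 (y_retract (var 2))" "is_binary_form 1 (y_retract (var 3))"
    unfolding 2 3 by (intro is_binary_form_add is_binary_form_const_mult is_binary_form_ab; assumption)+
  moreover have "i \<in> {1, 2, 3}" unfolding UNIV_3[symmetric] ..
  ultimately show ?thesis by blast
qed

text \<open>The retraction turns a monomial of degree \<open>d\<close> into a product of
  \<open>d\<close> linear forms in \<open>mpol_a\<close> and \<open>mpol_b\<close>.\<close>

lemma is_binary_form_y_retract:
  assumes "homogeneous (int d) f"
  shows "is_binary_form d (y_retract f)"
proof -
  have prod: "is_binary_form (\<Sum>i\<in>A. e i) (\<Prod>i\<in>A. y_retract (var i) ^ e i)" for A and e :: "3 \<Rightarrow> nat"
  proof (induction A rule: infinite_finite_induct)
    case (insert i A)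
    then show ?case
      using is_binary_form_mult[OF is_binary_form_power[OF is_binary_form_y_retract_var, of "e i" i] insert.IH]
      by simp
  qed (use is_binary_form_const[of 1] in auto)
  have "is_binary_form d (\<Sum>m\<in>A. const (coef f m) * (\<Prod>i\<in>UNIV. y_retract (var i) ^ Poly_Mapping.lookup m i))"
    if "A \<subseteq> Poly_Mapping.keys f" for A
    using finite_subset[OF that finite_keys] that
  proof (induction A)
    case (insert m A)
    then have "mon_degree m = d" using assms by (auto simp: homogeneous_def)
    then show ?case
      using insert prod[of "Poly_Mapping.lookup m" UNIV]
      by (auto simp: mon_degree_def intro!: is_binary_form_add is_binary_form_const_mult)
  qed (simp add: is_binary_form_0)
  from this[OF subset_refl] show ?thesis
    by (simp add: y_retract_def subst_def[of _ f])
qed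

end

definition a_retract :: "(3, 'a::field) mpol \<Rightarrow> (3, 'a) mpol" where
  "a_retract = subst (\<lambda>i. if i = 2 then var 1 else var i)"

lemma a_dvd_iff: "mpol_a dvd f \<longleftrightarrow> a_retract f = 0"
proof
  assume "mpol_a dvd f"
  then show "a_retract f = 0"
    by (auto simp: a_retract_def mpol_a_def subst_mult subst_diff elim!: dvdE)
next
  assume "a_retract f = 0"
  moreover have "mpol_a dvd f - a_retract f"
    unfolding a_retract_def
  proof (rule dvd_diff_subst)
    fix i :: 3
    show "mpol_a dvd var i - (if i = 2 then var 1 else var i)"
      using dvd_minus_iff[of mpol_a mpol_a] by (auto simp: mpol_a_def)
  qed
  ultimately show "mpol_a dvd f" by simp
qed

text \<open>\<open>mpol_a\<close> generates the kernel of \<open>a_retract\<close>, hence is prime,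
  and it does not divide \<open>mpol_b\<close>; its factors are split off one at a time.\<close>

lemma a_power_dvd:
  fixes f :: "(3, 'a::field) mpol"
  assumes "mpol_a ^ n dvd mpol_b ^ m * f"
  shows "mpol_a ^ n dvd f"
  using assms
proof (induction n arbitrary: f)
  case (Suc n)
  have "mpol_a dvd mpol_b ^ m * f"
    using Suc.prems by (metis dvd_mult_left power_Suc)
  then have "a_retract (mpol_b ^ m) * a_retract f = 0"
    by (simp add: a_dvd_iff) (simp add: a_retract_def subst_mult)
  moreover have "a_retract (mpol_b ^ m) \<noteq> (0 :: (3, 'a) mpol)"
    using var_diff_nonzero[of 1 "3 :: 3", where 'a = 'a] by (simp add: a_retract_def mpol_b_def subst_power subst_diff)
  ultimately obtain g where g: "f = mpol_a * g"
    using a_dvd_iff by (metis mult_eq_0_iff dvdE)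
  have "mpol_a \<noteq> (0 :: (3, 'a) mpol)"
    using var_diff_nonzero[of 1 "2 :: 3", where 'a = 'a] by (simp add: mpol_a_def)
  then have "mpol_a ^ n dvd mpol_b ^ m * g"
    using Suc.prems unfolding g by (simp add: mult.left_commute)
  then show ?case
    using Suc.IH[of g] g by (simp add: mult_dvd_mono)
qed simp

section \<open>Regular sequences\<close>

lemma mem_ideal_generated_1: "x \<in> ideal_generated {f} \<longleftrightarrow> f dvd x"
  for f :: "'r::comm_ring_1"
  unfolding ring_module.span_singleton by (auto simp: dvd_def image_iff mult.commute)

lemma mem_ideal_generated_2: "x \<in> ideal_generated {f, g} \<longleftrightarrow> (\<exists>u v. x = u * f + v * g)"
  for f g :: "'r::comm_ring_1"
proof
  assume "x \<in> ideal_generated {f, g}"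
  then obtain u v where "x = u + f * v" "g dvd u"
    unfolding ideal_generated_insert[of f "{g}"] mem_ideal_generated_1 by blast
  then obtain w where "x = g * w + f * v" by (auto elim: dvdE)
  then show "\<exists>u v. x = u * f + v * g"
    by (intro exI[of _ v] exI[of _ w]) (simp add: mult.commute add.commute)
next
  assume "\<exists>u v. x = u * f + v * g"
  then obtain u v where "x = u * f + v * g" by blast
  moreover have "f \<in> ideal_generated {f, g}" "g \<in> ideal_generated {f, g}"
    by (simp_all add: ring_module.span_base)
  ultimately show "x \<in> ideal_generated {f, g}"
    by (simp add: ring_module.span_add ring_module.span_scale)
qed

lemma ideal_generated_proper:
  fixes S :: "('n::finite, 'a::comm_ring_1) mpol set"
  assumes "\<And>f. f \<in> S \<Longrightarrow> \<exists>d>0. homogeneous (int d) f"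
  shows "ideal_generated S \<noteq> UNIV"
proof
  assume "ideal_generated S = UNIV"
  then have "1 \<in> ideal_generated S" by simp
  moreover have "hom_component 0 g = 0" if "g \<in> ideal_generated S" for g
    using that
  proof (induction rule: ring_module.span_induct_alt)
    case (step c x y)
    obtain d where "d > 0" "homogeneous (int d) x" using assms step by blast
    then have "hom_component 0 (x * c) = 0"
      using hom_component_mult_homogeneous[of d x 0 c] by simp
    with step show ?case by (simp add: hom_component_add mult.commute)
  qed (simp add: hom_component_zero)
  ultimately have "hom_component 0 (1 :: ('n, 'a) mpol) = 0" by blast
  then show False by (simp add: hom_component_0_const)
qed

lemma regular_sequence_3I:
  fixes f g h :: "'r::idom"
  assumes "f \<noteq> 0" "\<And>x. f dvd g * x \<Longrightarrow> f dvd x"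
    and "\<And>x u v. h * x = u * f + v * g \<Longrightarrow> \<exists>u v. x = u * f + v * g"
    and "ideal_generated {f, g, h} \<noteq> UNIV"
  shows "regular_sequence [f, g, h]"
  unfolding regular_sequence_def
proof (intro conjI allI impI)
  fix i x
  assume i: "i < length [f, g, h]"
    and x: "[f, g, h] ! i * x \<in> ideal_generated (set (take i [f, g, h]))"
  from i consider "i = 0" | "i = 1" | "i = 2" by fastforce
  then show "x \<in> ideal_generated (set (take i [f, g, h]))"
  proof cases
    case 1
    then show ?thesis using x assms(1) by (simp add: ring_module.span_empty)
  next
    case 2
    have "f dvd g * x" using x 2 by (simp add: mem_ideal_generated_1)
    then have "f dvd x" by (rule assms(2))
    with 2 show ?thesis by (simp add: mem_ideal_generated_1)
  next
    case 3
    have "h * x \<in> ideal_generated {f, g}" using x 3 by simp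
    then have "x \<in> ideal_generated {f, g}"
      using assms(3) unfolding mem_ideal_generated_2 by blast
    then show ?thesis using 3 by simp
  qed
next
  show "ideal_generated (set [f, g, h]) \<noteq> UNIV"
    using assms(4) by (simp add: insert_commute)
qed

lemma mpol_nonzero [simp]: "mpol_y \<noteq> (0 :: (3, 'a::field) mpol)" "mpol_a \<noteq> (0 :: (3, 'a) mpol)"
proof -
  have "subst (\<lambda>i. if i = 1 then 1 else 0) mpol_y = (1 :: (3, 'a) mpol)"
    by (simp add: mpol_y_eq subst_add)
  then show "mpol_y \<noteq> (0 :: (3, 'a) mpol)" by (metis subst_0 zero_neq_one)
  show "mpol_a \<noteq> (0 :: (3, 'a) mpol)"
    using var_diff_nonzero[of 1 "2 :: 3", where 'a = 'a] by (simp add: mpol_a_def)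
qed

section \<open>Regularity from powers of \<open>mpol_a\<close> and \<open>mpol_b\<close> in the
  ideal of \<open>g1\<close> and \<open>g2\<close>\<close>

context
  fixes g1 g2 :: "(3, 'a::field) mpol" and n :: nat
  assumes three: "(3 :: 'a) \<noteq> 0"
    and g1: "y_retract g1 = g1" "g1 \<noteq> 0" and g2: "y_retract g2 = g2"
    and a_mem: "\<exists>u v. mpol_a ^ n = u * g1 + v * g2"
    and b_mem: "\<exists>u v. mpol_b ^ n = u * g1 + v * g2"
begin

text \<open>The assumptions \<open>a_mem\<close> and \<open>b_mem\<close> stand for coprimality of
  \<open>g1\<close> and \<open>g2\<close>: they make \<open>g1\<close> divide
  \<open>mpol_a ^ n * f\<close> and \<open>mpol_b ^ n * f\<close>, and these two powers are
  coprime.\<close>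

lemma dvd_cofactor:
  assumes "g1 dvd g2 * f"
  shows "g1 dvd f"
proof -
  have dvd: "g1 dvd h * f" if h: "\<exists>u v. h = u * g1 + v * g2" for h
  proof -
    obtain u v where "h = u * g1 + v * g2" using h by blast
    then have "h * f = g1 * (u * f) + v * (g2 * f)" by (simp add: algebra_simps)
    then show ?thesis using assms by (metis dvd_add dvd_mult dvd_triv_left)
  qed
  obtain w where w: "mpol_a ^ n * f = g1 * w" using dvd[OF a_mem] by (auto elim: dvdE)
  obtain w' where w': "mpol_b ^ n * f = g1 * w'" using dvd[OF b_mem] by (auto elim: dvdE)
  \<comment> \<open>Comparing the two quotients shows that \<open>mpol_a ^ n\<close> divides
    \<open>mpol_b ^ n * w\<close>, hence \<open>w\<close>.\<close>
  have "g1 * (mpol_b ^ n * w) = mpol_b ^ n * (mpol_a ^ n * f)"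
    unfolding w by (simp add: mult.left_commute)
  also have "\<dots> = mpol_a ^ n * (mpol_b ^ n * f)"
    by (simp add: mult.left_commute)
  also have "\<dots> = g1 * (mpol_a ^ n * w')"
    unfolding w' by (simp add: mult.left_commute)
  finally have "mpol_b ^ n * w = mpol_a ^ n * w'"
    using g1(2) by simp
  then obtain z where z: "w = mpol_a ^ n * z"
    using a_power_dvd[of n n w] by (metis dvd_triv_left dvdE)
  then have "mpol_a ^ n * f = mpol_a ^ n * (g1 * z)"
    using w by (simp add: mult.left_commute)
  then have "f = g1 * z" using mpol_nonzero(2) by simp
  then show ?thesis by simp
qed

text \<open>\<open>y_retract\<close> fixes \<open>g1\<close> and \<open>g2\<close> and kills the
  left side. Subtracting the retracted relation leaves coefficients divisible by
  \<open>mpol_y\<close>, and one factor cancels.\<close>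

lemma y_power_cofactor:
  "mpol_y ^ k * f = u * g1 + v * g2 \<Longrightarrow> \<exists>u v. f = u * g1 + v * g2"
proof (induction k arbitrary: f u v)
  case (Suc k)
  have "\<exists>u v. mpol_y ^ k * f = u * g1 + v * g2"
  proof -
    have eq: "mpol_y * (mpol_y ^ k * f) = u * g1 + v * g2"
      using Suc.prems by (simp add: mult.assoc)
    have "0 = y_retract u * g1 + y_retract v * g2"
      using arg_cong[OF eq, of y_retract] g1 g2 three
      by (simp add: y_retract_mult[OF three] y_retract_add[OF three])
    then have "mpol_y * (mpol_y ^ k * f) = (u - y_retract u) * g1 + (v - y_retract v) * g2"
      unfolding eq by (simp add: algebra_simps)
    moreover obtain u' v' where "u - y_retract u = mpol_y * u'" "v - y_retract v = mpol_y * v'"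
      using y_dvd_diff_retract[OF three] by (meson dvdE)
    ultimately have "mpol_y * (mpol_y ^ k * f) = mpol_y * (u' * g1 + v' * g2)"
      by (simp add: algebra_simps)
    then show ?thesis using mpol_nonzero(1) by (metis mult_left_cancel)
  qed
  then show ?case using Suc.IH by blast
qed auto

lemma y_power_dvd_cofactor: "mpol_y ^ k dvd g1 * f \<Longrightarrow> mpol_y ^ k dvd f"
proof (induction k arbitrary: f)
  case (Suc k)
  have "\<not> mpol_y dvd g1" using g1 y_dvd_iff[OF three, of g1] by simp
  moreover have "mpol_y dvd g1 * f" using Suc.prems by (metis dvd_mult_left power_Suc)
  ultimately obtain h where h: "f = mpol_y * h" using y_prime[OF three] by (meson dvdE)
  have "mpol_y * mpol_y ^ k dvd mpol_y * (g1 * h)"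
    using Suc.prems unfolding h by (simp add: mult.left_commute)
  then have "mpol_y ^ k dvd g1 * h" using mpol_nonzero(1) by simp
  then show ?case using Suc.IH[of h] unfolding h by (simp add: mult_dvd_mono)
qed simp

lemma y_power_g1_cofactor:
  "g2 * f = u * mpol_y ^ k + v * g1 \<Longrightarrow> \<exists>u v. f = u * mpol_y ^ k + v * g1"
proof (induction k arbitrary: f u v)
  case 0
  then show ?case by (intro exI[of _ f] exI[of _ 0]) simp
next
  case (Suc k)
  have "y_retract (g2 * f) = y_retract (u * (mpol_y * mpol_y ^ k) + v * g1)"
    using Suc.prems by simp
  \<comment> \<open>Retraction kills the power of \<open>mpol_y\<close>, so
    \<open>dvd_cofactor\<close> applies to the retract of \<open>f\<close>; the rest of
    \<open>f\<close> is a multiple of \<open>mpol_y\<close> and goes to the induction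
    hypothesis.\<close>
  then have "g2 * y_retract f = y_retract v * g1"
    using g1 g2 three by (simp add: y_retract_mult[OF three] y_retract_add[OF three])
  then obtain w where w: "y_retract f = g1 * w"
    using dvd_cofactor[of "y_retract f"] by (metis dvd_triv_right dvdE)
  obtain f' where f': "f - y_retract f = mpol_y * f'"
    using y_dvd_diff_retract[OF three] by (meson dvdE)
  have eq: "mpol_y * (g2 * f' - u * mpol_y ^ k) = g1 * (v - g2 * w)"
  proof -
    have "mpol_y * (g2 * f' - u * mpol_y ^ k) = g2 * (mpol_y * f') - u * mpol_y ^ Suc k"
      by (simp add: algebra_simps)
    also have "\<dots> = g2 * f - g2 * (g1 * w) - u * mpol_y ^ Suc k"
      unfolding f'[symmetric] w by (simp add: algebra_simps)
    also have "\<dots> = g1 * (v - g2 * w)"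
      unfolding Suc.prems by (simp add: algebra_simps)
    finally show ?thesis .
  qed
  then obtain v' where "v - g2 * w = mpol_y * v'"
    using y_power_dvd_cofactor[of 1 "v - g2 * w"] by (metis dvdE dvd_triv_left power_one_right)
  with eq have "mpol_y * (g2 * f' - u * mpol_y ^ k) = mpol_y * (g1 * v')"
    by (simp add: mult.left_commute)
  then have "g2 * f' - u * mpol_y ^ k = g1 * v'"
    using mpol_nonzero(1) by (metis mult_left_cancel)
  then have "g2 * f' = u * mpol_y ^ k + v' * g1"
    by (simp add: algebra_simps)
  then obtain u2 v2 where "f' = u2 * mpol_y ^ k + v2 * g1" using Suc.IH by blast
  then have "f = u2 * mpol_y ^ Suc k + (w + mpol_y * v2) * g1"
    using f' w by (simp add: algebra_simps)
  then show ?case by blast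
qed

text \<open>The degree lists put \<open>p\<close> first in one range and last in the others, so each
  order is verified directly.\<close>

lemma regular_sequences:
  assumes "homogeneous (int d) g1" "homogeneous (int d) g2" "d > 0" "k > 0"
  shows "regular_sequence [mpol_y ^ k, g1, g2]" and "regular_sequence [g1, g2, mpol_y ^ k]"
proof -
  have yk: "homogeneous (int k) (mpol_y ^ k :: (3, 'a) mpol)"
    using homogeneous_power[OF homogeneous_yab(1), of k] by simp
  have proper: "ideal_generated {mpol_y ^ k, g1, g2} \<noteq> UNIV"
    using assms yk by (intro ideal_generated_proper) blast
  show "regular_sequence [mpol_y ^ k, g1, g2]"
  proof (rule regular_sequence_3I)
    show "mpol_y ^ k dvd x" if "mpol_y ^ k dvd g1 * x" for x
      using that by (rule y_power_dvd_cofactor)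
    show "\<exists>u v. x = u * mpol_y ^ k + v * g1" if "g2 * x = u * mpol_y ^ k + v * g1" for x u v
      using that by (rule y_power_g1_cofactor)
  qed (use proper in simp_all)
  show "regular_sequence [g1, g2, mpol_y ^ k]"
  proof (rule regular_sequence_3I)
    show "ideal_generated {g1, g2, mpol_y ^ k} \<noteq> UNIV"
      using proper by (simp add: insert_commute)
    show "g1 dvd x" if "g1 dvd g2 * x" for x
      using that by (rule dvd_cofactor)
    show "\<exists>u v. x = u * g1 + v * g2" if "mpol_y ^ k * x = u * g1 + v * g2" for x u v
      using that by (rule y_power_cofactor)
  qed (rule g1(2))
qed

end

text \<open>The linear forms \<open>mpol_y\<close>, \<open>mpol_a\<close>, \<open>mpol_b\<close> are
  a regular sequence generating the ideal of all variables, whose series is 1. This gives the series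
  of the ring without counting monomials.\<close>

lemma hilbert_zero_ideal:
  assumes three: "(3 :: 'a::field) \<noteq> 0"
  shows "(1 - fps_X) ^ 3 * hilbert {0 :: (3, 'a) mpol} = 1"
proof -
  have hom: "homogeneous (int 1) (mpol_y :: (3, 'a) mpol)" "homogeneous (int 1) (mpol_a :: (3, 'a) mpol)"
    "homogeneous (int 1) (mpol_b :: (3, 'a) mpol)"
    using homogeneous_yab by simp_all
  have nonzero: "mpol_b \<noteq> (0 :: (3, 'a) mpol)"
    using var_diff_nonzero[of 1 "3 :: 3", where 'a = 'a] by (simp add: mpol_b_def)
  have "regular_sequence [mpol_y ^ 1, mpol_a, mpol_b :: (3, 'a) mpol]"
  proof (rule regular_sequences(1)[OF three, where n = 1 and d = 1])
    show "\<exists>u v. mpol_a ^ 1 = u * mpol_a + v * (mpol_b :: (3, 'a) mpol)"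
      by (intro exI[of _ 1] exI[of _ 0]) simp
    show "\<exists>u v. mpol_b ^ 1 = u * mpol_a + v * (mpol_b :: (3, 'a) mpol)"
      by (intro exI[of _ 0] exI[of _ 1]) simp
  qed (use three hom mpol_nonzero in simp_all)
  then have reg: "regular_sequence [mpol_y, mpol_a, mpol_b :: (3, 'a) mpol]"
    by simp
  let ?I = "ideal_generated (set [mpol_y, mpol_a, mpol_b :: (3, 'a) mpol])"
  have "hilbert ?I = (\<Prod>d\<leftarrow>[1, 1, 1]. 1 - fps_X ^ d) * hilbert {0 :: (3, 'a) mpol}"
  proof (rule hilbert_regular_sequence)
    show "list_all2 (\<lambda>d f. f \<noteq> 0 \<and> homogeneous (int d) f) [1, 1, 1] [mpol_y, mpol_a, mpol_b :: (3, 'a) mpol]"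
      using hom mpol_nonzero nonzero by simp
  qed (use reg in \<open>auto simp: regular_sequence_def\<close>)
  moreover have "hilbert ?I = 1"
  proof (rule hilbert_maximal_ideal)
    show "?I \<noteq> UNIV" using reg by (simp add: regular_sequence_def)
    show "hom_component d g \<in> ?I" if "g \<in> ?I" for g d
    proof (rule hom_component_ideal_generated[OF _ that])
      fix f assume "f \<in> set [mpol_y, mpol_a, mpol_b :: (3, 'a) mpol]"
      then have "homogeneous (int 1) f" using hom by auto
      then show "\<exists>d. homogeneous (int d) f" ..
    qed
    have idI: "ideal ?I" by (rule ring_module.subspace_span)
    then show "ideal ?I" .
    have gen: "mpol_y \<in> ?I" "mpol_a \<in> ?I" "mpol_b \<in> ?I"
      by (auto intro: ring_module.span_base)
    have third: "const (1 / 3) * 3 = (1 :: (3, 'a) mpol)"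
    proof -
      have "const (1 / 3) * 3 = (const (1 / 3 * 3) :: (3, 'a) mpol)"
        unfolding const_mult by simp
      then show ?thesis using three by simp
    qed
    have "const (1 / 3) * (mpol_y + mpol_a + mpol_b) \<in> ?I"
      using gen by (intro ring_module.span_scale ring_module.span_add)
    also have "mpol_y + mpol_a + mpol_b = 3 * (var 1 :: (3, 'a) mpol)"
      by (simp add: mpol_y_eq mpol_a_def mpol_b_def)
    also have "const (1 / 3) * \<dots> = var 1"
      unfolding mult.assoc[symmetric] third by simp
    finally have 1: "var 1 \<in> ?I" .
    have 2: "var 2 \<in> ?I" "var 3 \<in> ?I"
      using ring_module.span_diff[OF 1 gen(2)] ring_module.span_diff[OF 1 gen(3)]
      by (simp_all add: mpol_a_def mpol_b_def)
    fix i :: 3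
    have "i \<in> {1, 2, 3}" unfolding UNIV_3[symmetric] ..
    with 1 2 show "var i \<in> ?I" by blast
  qed
  ultimately show ?thesis
    by (simp add: power3_eq_cube mult.assoc)
qed

section \<open>The derivation along the direction (1, 1, 1)\<close>

context
  assumes three: "(3 :: 'a::field) \<noteq> 0"
begin

definition total_diff :: "(3, 'a) mpol \<Rightarrow> (3, 'a) mpol" where
  "total_diff f = (\<Sum>k\<in>UNIV. partial_diff k f)"

lemma total_diff_add: "total_diff (f + g) = total_diff f + total_diff g"
  by (simp add: total_diff_def partial_diff_add sum.distrib)

lemma total_diff_mult: "total_diff (f * g) = total_diff f * g + f * total_diff g"
  by (simp add: total_diff_def partial_diff_mult sum.distrib sum_distrib_left sum_distrib_right)

lemma total_diff_const: "total_diff (const a) = 0"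
  by (simp add: total_diff_def)

lemma total_diff_var: "total_diff (var i) = 1"
  by (simp add: total_diff_def partial_diff_var)

lemma total_diff_diff: "total_diff (f - g) = total_diff f - total_diff g"
  using total_diff_add[of "f - g" g] by simp

lemma total_diff_y: "total_diff mpol_y = 3"
  unfolding mpol_y_eq by (simp add: total_diff_add total_diff_var)

text \<open>A retracted variable is \<open>x_i - y / 3\<close>, with derivative
  \<open>1 - 3 / 3\<close>; the product rule extends the vanishing to all retracts.\<close>

lemma total_diff_y_retract: "total_diff (y_retract f) = 0"
proof (induction f rule: mpol_induct)
  case (const a)
  show ?case by (simp add: y_retract_const three total_diff_const)
next
  case (var i)
  have "total_diff (y_retract (var i)) = 1 - const (1 / 3) * 3"
    by (simp add: y_retract_def[OF three] total_diff_diff total_diff_mult total_diff_const total_diff_var total_diff_y)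
  also have "const (1 / 3) * 3 = (const (1 / 3 * 3) :: (3, 'a) mpol)"
    unfolding const_mult by simp
  finally show ?case using three by simp
next
  case (add f g)
  then show ?case by (simp add: y_retract_add three total_diff_add)
next
  case (mult f g)
  then show ?case by (simp add: y_retract_mult three total_diff_mult)
qed

lemma total_diff_y_power: "total_diff (mpol_y ^ Suc k) = const (of_nat (3 * Suc k)) * mpol_y ^ k"
proof (induction k)
  case 0
  show ?case by (simp add: total_diff_y)
next
  case (Suc k)
  have "total_diff (mpol_y ^ Suc (Suc k)) = 3 * mpol_y ^ Suc k + mpol_y * total_diff (mpol_y ^ Suc k)"
    by (simp only: power_Suc total_diff_mult total_diff_y)
  also have "\<dots> = (const 3 + const (of_nat (3 * Suc k))) * mpol_y ^ Suc k"
    unfolding Suc by (simp add: algebra_simps)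
  also have "const 3 + const (of_nat (3 * Suc k)) = (const (of_nat (3 * Suc (Suc k))) :: (3, 'a) mpol)"
    unfolding const_add[symmetric] by (simp add: algebra_simps)
  finally show ?case .
qed

text \<open>If \<open>f - y_retract f = mpol_y ^ k * w\<close> with \<open>0 < k < p\<close>, then
  \<open>mpol_y ^ k\<close> divides \<open>3 * k * mpol_y ^ (k - 1) * w\<close>, because it divides
  the derivative and its other Leibniz term. As \<open>3 * k\<close> is invertible,
  \<open>mpol_y\<close> divides \<open>w\<close>.\<close>

lemma y_power_dvd_diff_retract:
  assumes p: "\<And>k. 0 < k \<Longrightarrow> k < p \<Longrightarrow> of_nat k \<noteq> (0 :: 'a)"
    and f: "mpol_y ^ p dvd total_diff f" and k: "k \<le> p"
  shows "mpol_y ^ k dvd f - y_retract f"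
  using k
proof (induction k)
  case (Suc k)
  let ?h = "f - y_retract f"
  show ?case
  proof (cases k)
    case 0
    then show ?thesis using y_dvd_diff_retract[OF three] by simp
  next
    case (Suc j)
    obtain w where w: "?h = mpol_y ^ k * w" using Suc.IH Suc.prems by (auto elim: dvdE)
    have "total_diff f = const (of_nat (3 * k)) * mpol_y ^ j * w + mpol_y ^ k * total_diff w"
    proof -
      have "total_diff f = total_diff ?h"
        by (simp add: total_diff_diff total_diff_y_retract)
      then show ?thesis
        unfolding w total_diff_mult Suc total_diff_y_power .
    qed
    moreover have "mpol_y ^ k dvd total_diff f"
      using f Suc.prems by (meson Suc_leD le_imp_power_dvd dvd_trans)
    ultimately have "mpol_y ^ k dvd const (of_nat (3 * k)) * mpol_y ^ j * w"
      by (metis dvd_add_left_iff dvd_triv_left)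
    then have "mpol_y ^ j * mpol_y dvd mpol_y ^ j * (const (of_nat (3 * k)) * w)"
      unfolding Suc by (simp add: mult_ac)
    then have "mpol_y dvd const (of_nat (3 * k)) * w"
      using mpol_nonzero(1) by simp
    then have "mpol_y dvd const (inverse (of_nat (3 * k))) * (const (of_nat (3 * k)) * w)"
      by (rule dvd_mult)
    moreover have "of_nat k \<noteq> (0 :: 'a)"
      using p[of k] Suc Suc.prems by simp
    then have "of_nat (3 * k) \<noteq> (0 :: 'a)"
      using three by simp
    ultimately have "mpol_y dvd w"
      unfolding mult.assoc[symmetric] const_mult[symmetric] by simp
    then show ?thesis unfolding w by (simp add: mult_dvd_mono)
  qed
qed simp

end

section \<open>Generators of the maximal graded submodule\<close>

lemma sum_hom_components: "f = (\<Sum>d\<in>mon_degree ` Poly_Mapping.keys f. hom_component d f)"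
  by (rule poly_mapping_eqI) (auto simp: lookup_sum hom_component_lookup in_keys_iff)

lemma hom_parts_subset:
  fixes I K :: "('n::finite, 'a::field) mpol set"
  assumes "ideal I" "\<And>d. hom_part K d \<subseteq> I" "\<And>f d. f \<in> K \<Longrightarrow> hom_component d f \<in> K"
  shows "K \<subseteq> I"
proof
  fix f assume "f \<in> K"
  then have "hom_component d f \<in> I" for d
    using assms(2)[of d] assms(3)[of f d] by (auto simp: hom_part_def)
  then have "(\<Sum>d\<in>mon_degree ` Poly_Mapping.keys f. hom_component d f) \<in> I"
    by (intro ring_module.subspace_sum[OF assms(1)])
  then show "f \<in> I"
    using sum_hom_components[of f] by simp
qed

text \<open>Truncated subtraction is harmless here, since \<open>p + 2 * d \<ge> 3\<close>.\<close>

lemma product_top_coefficient: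
  fixes H :: "rat fps"
  assumes H: "(1 - fps_X) ^ 3 * H = (1 - fps_X ^ p) * (1 - fps_X ^ d) ^ 2" and "p > 0" "d > 0"
  shows "fps_nth H (p + 2 * d - 3) = 1"
proof -
  \<comment> \<open>The geometric sum. After cancelling \<open>(1 - fps_X) ^ 3\<close> the series is
    a product of three monic polynomials, so its leading coefficient is 1.\<close>
  define q :: "nat \<Rightarrow> rat poly" where "q n = (\<Sum>i<n. monom 1 i)" for n
  have coeff_q: "poly.coeff (q n) i = of_bool (i < n)" for n i
    by (simp add: q_def coeff_sum coeff_monom)
  have deg_q: "degree (q n) = n - 1" if "n > 0" for n
    using that by (intro antisym degree_le le_degree) (auto simp: coeff_q)
  have lead_q: "lead_coeff (q n) = 1" if "n > 0" for n
    using that by (simp add: deg_q coeff_q)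
  have geometric: "1 - fps_X ^ n = (1 - fps_X) * fps_of_poly (q n)" for n
    unfolding q_def fps_of_poly_sum by (simp add: fps_of_poly_monom one_diff_power_eq)
  have "fps_nth (1 - fps_X :: rat fps) 0 \<noteq> 0" by simp
  then have "(1 - fps_X :: rat fps) ^ 3 \<noteq> 0" by (metis fps_zero_nth power_not_zero)
  moreover have "(1 - fps_X) ^ 3 * H = (1 - fps_X) ^ 3 * fps_of_poly (q p * (q d * q d))"
    unfolding H geometric[of p] geometric[of d] fps_of_poly_mult
    by (simp add: power3_eq_cube power2_eq_square mult_ac)
  ultimately have "H = fps_of_poly (q p * (q d * q d))"
    by (metis mult_left_cancel)
  moreover have "poly.coeff (q p * (q d * q d)) (degree (q p) + degree (q d * q d)) = 1"
    using assms(2,3) by (simp add: coeff_mult_degree_sum lead_coeff_mult lead_q)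
  moreover have "degree (q p) + degree (q d * q d) = p + 2 * d - 3"
  proof -
    have "q d \<noteq> 0" using lead_q[OF assms(3)] by auto
    then show ?thesis using assms(2,3) by (simp add: degree_mult_eq deg_q)
  qed
  ultimately show ?thesis by simp
qed

lemma homogeneous_partial_diff:
  assumes "homogeneous (int d) f"
  shows "homogeneous (int (d - 1)) (partial_diff k f)"
proof (cases d)
  case 0
  then have "f = const (coef f 0)" using homogeneous_degree_0[of f] assms by simp
  then have "partial_diff k f = 0" by (metis partial_diff_const)
  then show ?thesis by simp
next
  case (Suc e)
  have "hom_component e (partial_diff k f) = partial_diff k f"
    using assms unfolding Suc homogeneous_iff_hom_component by (simp add: hom_component_partial_diff)
  then have "homogeneous (int e) (partial_diff k f)"
    by (simp only: homogeneous_iff_hom_component)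
  then show ?thesis unfolding Suc by simp
qed

text \<open>Multiplying \<open>bezout_degree_bound\<close> by \<open>g\<close> and homogenizing: the
  degree bounds on the cofactors are what makes all products of forms come out in degree
  \<open>d - r + n\<close>.\<close>

lemma ideal_of_bezout_forms:
  fixes h1 h2 g :: "'a::field poly"
  assumes bezout: "u * h1 + v * h2 = 1" "h1 \<noteq> 0" "degree h1 = r" "degree h2 \<le> r"
    and g: "degree g + r \<le> d"
    and n: "2 * r - 1 \<le> n" "degree f \<le> n"
  shows "\<exists>w1 w2. binary_form (d - r) g * binary_form n f =
    w1 * binary_form d (g * h1) + w2 * binary_form d (g * h2)"
proof -
  obtain w1 w2 where w: "f = w1 * h1 + w2 * h2" "degree w1 + r \<le> n" "degree w2 + r \<le> n"
    by (rule bezout_degree_bound[OF bezout n])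
  have *: "binary_form (d - r + n) (g * (w * h)) = binary_form (n - r) w * binary_form d (g * h)"
    if "degree w + r \<le> n" "degree h \<le> r" for w h :: "'a poly"
  proof -
    have "degree w \<le> n - r" using that by simp
    moreover have "degree (g * h) \<le> d"
      using degree_mult_le[of g h] that g by linarith
    ultimately have "binary_form (n - r) w * binary_form d (g * h) = binary_form (n - r + d) (w * (g * h))"
      by (rule binary_form_mult)
    moreover have "n - r + d = d - r + n" using that g by simp
    moreover have "w * (g * h) = g * (w * h)" by (simp only: mult.left_commute)
    ultimately show ?thesis by simp
  qed
  have "degree g \<le> d - r" using g by simp
  then have "binary_form (d - r) g * binary_form n f = binary_form (d - r + n) (g * f)"
    using n(2) by (rule binary_form_mult)
  also have "g * f = g * (w1 * h1) + g * (w2 * h2)"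
    unfolding w(1) by (rule distrib_left)
  finally have "binary_form (d - r) g * binary_form n f =
      binary_form (n - r) w1 * binary_form d (g * h1) + binary_form (n - r) w2 * binary_form d (g * h2)"
    unfolding binary_form_add using *[OF w(2)] *[OF w(3)] assms(3,4) by simp
  then show ?thesis by blast
qed

section \<open>The maximal submodule under the Hilbert series hypothesis\<close>

context
  fixes p d :: nat and c :: "'a::field" and J :: "(3, 'a) mpol set"
  assumes p3: "p > 3" and char: "CHAR('a) = p"
    and J: "J = J_max c"
    and d: "d > 0"
    and hilbert_J: "hilbert J = (1 - fps_X ^ p) * (1 - fps_X ^ d) ^ 2 * hilbert {0 :: (3, 'a) mpol}"
begin

lemma of_nat_nonzero: "0 < k \<Longrightarrow> k < p \<Longrightarrow> of_nat k \<noteq> (0 :: 'a)"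
  using char by (simp add: of_nat_eq_0_iff_char_dvd nat_dvd_not_less)

lemma two_three_nonzero: "(2 :: 'a) \<noteq> 0" "(3 :: 'a) \<noteq> 0"
  using of_nat_nonzero[of 2] of_nat_nonzero[of 3] p3 by simp_all

lemma homogeneous_y_power: "homogeneous (int k) (mpol_y ^ k :: (3, 'a) mpol)"
  using homogeneous_power[OF homogeneous_yab(1), of k] by simp

lemma y_power_in_J: "mpol_y ^ p \<in> J"
proof (rule symmetric_constant_in_J_max[OF J homogeneous_y_power])
  show "p > 0" using p3 by simp
  show "permute_vars \<sigma> (mpol_y ^ p) = (mpol_y ^ p :: (3, 'a) mpol)" if "bij \<sigma>" for \<sigma> :: "3 \<Rightarrow> 3"
  proof -
    have "permute_vars \<sigma> mpol_y = (\<Sum>i\<in>UNIV. var (\<sigma> i) :: (3, 'a) mpol)"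
      using that by (simp add: mpol_y_def permute_vars_sum permute_vars_var)
    also have "\<dots> = mpol_y"
      unfolding mpol_y_def by (rule sum.reindex_bij_betw[OF that])
    finally show ?thesis using that by (simp add: permute_vars_power)
  qed
  show "partial_diff k (mpol_y ^ p) = (0 :: (3, 'a) mpol)" for k
  proof -
    obtain n where n: "p = Suc n" using p3 by (cases p) auto
    have "of_nat p = (0 :: 'a)" using char of_nat_CHAR by metis
    then have "of_nat p = (0 :: (3, 'a) mpol)" using const_of_nat[of p] by (metis const_0)
    then show ?thesis
      unfolding n partial_diff_power by simp
  qed
qed

definition y_power_ideal :: "(3, 'a) mpol set" where "y_power_ideal = ideal_generated {mpol_y ^ p}"

lemma ideal_y_power_ideal: "ideal y_power_ideal"
  unfolding y_power_ideal_def by (rule ring_module.subspace_span)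

lemma mem_y_power_ideal: "f \<in> y_power_ideal \<longleftrightarrow> mpol_y ^ p dvd f"
  by (simp add: y_power_ideal_def mem_ideal_generated_1)

lemma y_power_ideal_subset: "y_power_ideal \<subseteq> J"
  unfolding y_power_ideal_def using y_power_in_J ideal_J_max[OF J] by (intro ring_module.span_minimal) auto

lemma y_power_ideal_proper: "y_power_ideal \<noteq> UNIV"
  using y_power_ideal_subset J_max_proper[OF J] by blast

lemma hilbert_J_eq: "hilbert J = hilbert y_power_ideal * (1 - fps_X ^ d) ^ 2"
proof -
  have "hilbert (ideal_generated (set [mpol_y ^ p :: (3, 'a) mpol])) = (\<Prod>d\<leftarrow>[p]. 1 - fps_X ^ d) * hilbert {0 :: (3, 'a) mpol}"
    by (rule hilbert_regular_sequence)
      (use homogeneous_y_power[of p] in \<open>simp_all add: ring_module.span_empty\<close>)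
  then have "hilbert y_power_ideal = (1 - fps_X ^ p) * hilbert {0 :: (3, 'a) mpol}"
    by (simp add: y_power_ideal_def)
  then show ?thesis
    unfolding hilbert_J by (simp add: mult_ac)
qed

text \<open>Up to degree \<open>d\<close> only \<open>1 - 2 * fps_X ^ d\<close> matters in the
  square, and the constant coefficient of \<open>hilbert y_power_ideal\<close> is 1.\<close>

lemma hilbert_J_nth:
  assumes "m \<le> d"
  shows "fps_nth (hilbert J) m = fps_nth (hilbert y_power_ideal) m - (if m = d then 2 else 0)"
proof -
  have "h * (1 - y) ^ 2 = h - (y * h + y * h) + y * (y * h)" for h y :: "rat fps"
    by algebra
  then have "hilbert J = hilbert y_power_ideal - (fps_X ^ d * hilbert y_power_ideal + fps_X ^ d * hilbert y_power_ideal) + fps_X ^ d * (fps_X ^ d * hilbert y_power_ideal)"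
    unfolding hilbert_J_eq .
  then have "fps_nth (hilbert J) m = fps_nth (hilbert y_power_ideal) m -
      (fps_nth (fps_X ^ d * hilbert y_power_ideal) m + fps_nth (fps_X ^ d * hilbert y_power_ideal) m) +
      fps_nth (fps_X ^ d * (fps_X ^ d * hilbert y_power_ideal)) m"
    by (simp only: fps_sub_nth fps_add_nth)
  then show ?thesis
    unfolding fps_X_power_mult_nth using assms d hilbert_nth_0[OF ideal_y_power_ideal y_power_ideal_proper] by auto
qed

lemma hom_part_low_degree: "m < d \<Longrightarrow> hom_part J m = hom_part y_power_ideal m"
  using hilbert_J_nth[of m] hilbert_nth_eq_iff[of J m y_power_ideal]
  by (intro hom_part_eqI[OF ideal_y_power_ideal y_power_ideal_subset, symmetric]) simp

text \<open>The sum of the Dunkl operators equals \<open>total_diff\<close> and maps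
  \<open>f\<close> into degree \<open>d - 1\<close> of \<open>J\<close>, where \<open>J\<close>
  consists of multiples of \<open>mpol_y ^ p\<close>.\<close>

lemma diff_y_retract_in_y_power_ideal:
  assumes f: "f \<in> hom_part J d"
  shows "f - y_retract f \<in> y_power_ideal"
proof -
  have "total_diff f = (\<Sum>k\<in>UNIV. dunkl c k f)"
    by (simp add: total_diff_def[OF two_three_nonzero(2)] sum_dunkl[OF two_three_nonzero(1)])
  moreover have "(\<Sum>k\<in>UNIV. dunkl c k f) \<in> J"
    using f by (intro ring_module.subspace_sum[OF ideal_J_max[OF J]] dunkl_J_max[OF J]) (simp add: hom_part_def)
  moreover have "homogeneous (int (d - 1)) (total_diff f)"
    using f unfolding total_diff_def[OF two_three_nonzero(2)]
    by (intro homogeneous_sum homogeneous_partial_diff) (simp add: hom_part_def)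
  ultimately have "total_diff f \<in> hom_part J (d - 1)"
    by (simp add: hom_part_def)
  also have "hom_part J (d - 1) = hom_part y_power_ideal (d - 1)"
    using d by (intro hom_part_low_degree) simp
  finally have "mpol_y ^ p dvd total_diff f"
    by (simp add: hom_part_def mem_y_power_ideal)
  then show ?thesis
    unfolding mem_y_power_ideal
    by (intro y_power_dvd_diff_retract[OF two_three_nonzero(2) of_nat_nonzero]) auto
qed

lemma y_retract_in_J:
  assumes f: "f \<in> hom_part J d"
  shows "y_retract f \<in> J"
proof -
  have "f - y_retract f \<in> J"
    using diff_y_retract_in_y_power_ideal[OF f] y_power_ideal_subset by blast
  moreover have "f \<in> J" using f by (simp add: hom_part_def)
  ultimately have "f - (f - y_retract f) \<in> J"
    using ring_module.subspace_diff[OF ideal_J_max[OF J]] by blast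
  then show ?thesis by simp
qed

text \<open>The retracts of two forms independent modulo \<open>y_power_ideal\<close> stay in
  \<open>J\<close>. A relation between them gives a combination with retract 0, which lies in
  \<open>y_power_ideal\<close> and so is trivial.\<close>

lemma two_forms_in_J:
  obtains P1 P2 where "degree P1 \<le> d" "degree P2 \<le> d" "binary_form d P1 \<in> J" "binary_form d P2 \<in> J"
    "\<And>\<alpha> \<beta>. smult \<alpha> P1 + smult \<beta> P2 = 0 \<Longrightarrow> \<alpha> = 0 \<and> \<beta> = 0"
proof -
  have "dim_over (hom_part J d) = dim_over (hom_part y_power_ideal d) + 2"
  proof -
    have "rat_of_nat (dim_over (hom_part J d)) = of_nat (dim_over (hom_part y_power_ideal d)) + 2"
      using hilbert_J_nth[of d] by (simp add: hilbert_def)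
    also have "\<dots> = of_nat (dim_over (hom_part y_power_ideal d) + 2)" by simp
    finally show ?thesis by (simp only: of_nat_eq_iff)
  qed
  then obtain f1 f2 where f: "f1 \<in> hom_part J d" "f2 \<in> hom_part J d"
    and indep: "\<And>\<alpha> \<beta>. const \<alpha> * f1 + const \<beta> * f2 \<in> y_power_ideal \<Longrightarrow> \<alpha> = 0 \<and> \<beta> = 0"
    by (rule two_independent_modulo[OF y_power_ideal_subset]) blast
  note three = two_three_nonzero(2)
  obtain P1 P2 where P: "degree P1 \<le> d" "y_retract f1 = binary_form d P1"
    "degree P2 \<le> d" "y_retract f2 = binary_form d P2"
    using f is_binary_form_y_retract[OF three, of d] unfolding hom_part_def is_binary_form_def[OF three] by blast
  show thesis
  proof (rule that[of P1 P2])
    show "binary_form d P1 \<in> J" "binary_form d P2 \<in> J"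
      using y_retract_in_J f P by metis+
    fix \<alpha> \<beta> assume 0: "smult \<alpha> P1 + smult \<beta> P2 = 0"
    let ?w = "const \<alpha> * f1 + const \<beta> * f2"
    have "y_retract ?w = binary_form d (smult \<alpha> P1 + smult \<beta> P2)"
      by (simp add: y_retract_add y_retract_mult y_retract_const three P binary_form_add binary_form_smult)
    then have w0: "y_retract ?w = 0" unfolding 0 by simp
    have w: "?w \<in> hom_part J d"
      using f ideal_J_max[OF J]
      by (auto simp: hom_part_def intro!: homogeneous_add homogeneous_const_mult ring_module.subspace_add ring_module.subspace_scale)
    have "?w \<in> y_power_ideal"
      using diff_y_retract_in_y_power_ideal[OF w] w0 by simp
    then show "\<alpha> = 0 \<and> \<beta> = 0" by (rule indep)
  qed (use P in auto)
qed

text \<open>The series is a polynomial of this degree with leading coefficient 1; \<open>w\<close>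
  is the witness fed to \<open>socle_J_max\<close>.\<close>

lemma top_form:
  obtains w where "homogeneous (int (p + 2 * d - 3)) w" "w \<notin> J"
proof -
  let ?s = "p + 2 * d - 3"
  have "(1 - fps_X) ^ 3 * hilbert J =
      (1 - fps_X ^ p) * (1 - fps_X ^ d) ^ 2 * ((1 - fps_X) ^ 3 * hilbert {0 :: (3, 'a) mpol})"
    unfolding hilbert_J by (simp only: mult_ac)
  then have "fps_nth (hilbert J) ?s = 1"
    using p3 d hilbert_zero_ideal[OF two_three_nonzero(2)]
    by (intro product_top_coefficient) simp_all
  then have "hom_part UNIV ?s \<noteq> hom_part J ?s"
    by (auto simp: hilbert_def)
  then obtain w where "homogeneous (int ?s) w" "w \<notin> J"
    unfolding hom_part_def by blast
  then show thesis by (rule that)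
qed

text \<open>Otherwise the form \<open>q\<close> of the common factor, of degree
  \<open>e < d\<close>, lies in \<open>J\<close> by the socle property. In that degree
  \<open>J\<close> contains only multiples of \<open>mpol_y ^ p\<close>, while \<open>q\<close> is a
  nonzero form free of \<open>mpol_y\<close>.\<close>

lemma no_common_factor:
  fixes h1 h2 g :: "'a poly"
  assumes bezout: "u * h1 + v * h2 = 1" "h1 \<noteq> 0" "degree h1 = r" "degree h2 \<le> r"
    and g: "g \<noteq> 0" "degree g + r \<le> d" and r: "r > 0"
    and forms: "binary_form d (g * h1) \<in> J" "binary_form d (g * h2) \<in> J"
  shows "r = d"
proof (rule ccontr)
  assume "r \<noteq> d"
  define e where "e = d - r"
  with \<open>r \<noteq> d\<close> g(2) have e: "e > 0" "e + r = d" by auto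
  define q where "q = binary_form e g"
  define s where "s = p + 2 * d - 3"
  note idJ = ideal_J_max[OF J] and three = two_three_nonzero(2)
  have base: "q * binary_form n f \<in> J" if n: "2 * r - 1 \<le> n" "degree f \<le> n" for n f
  proof -
    obtain w1 w2 where "q * binary_form n f = w1 * binary_form d (g * h1) + w2 * binary_form d (g * h2)"
      using ideal_of_bezout_forms[OF bezout g(2) n] unfolding q_def e_def by blast
    then show ?thesis
      using forms by (simp add: ring_module.subspace_add[OF idJ] ring_module.subspace_scale[OF idJ])
  qed
  \<comment> \<open>Downward induction on \<open>i\<close> from \<open>i = p\<close>, where the
    power itself is in \<open>J\<close>: \<open>f\<close> splits into its retract, handled by
    \<open>base\<close>, and a multiple of \<open>mpol_y\<close>, which raises
    \<open>i\<close>.\<close>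
  have top: "mpol_y ^ i * (q * f) \<in> J" if "i \<le> p" "m + i + e = s" "homogeneous (int m) f" for i m f
    using that
  proof (induction i arbitrary: m f rule: inc_induct)
    case base
    then show ?case
      using ring_module.subspace_scale[OF idJ y_power_in_J, of "q * f"] by (simp add: mult.commute)
  next
    case (step i)
    obtain P where P: "degree P \<le> m" "y_retract f = binary_form m P"
      using is_binary_form_y_retract[OF three step.prems(2)] unfolding is_binary_form_def[OF three] by blast
    obtain f' where f': "f - y_retract f = mpol_y * f'"
      using y_dvd_diff_retract[OF three] by (meson dvdE)
    have "homogeneous (int m) (f - y_retract f)"
      unfolding P(2) by (intro homogeneous_diff step.prems(2) homogeneous_binary_form)
    moreover have "homogeneous (int 1) (mpol_y :: (3, 'a) mpol)"
      using homogeneous_yab(1) by simp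
    ultimately have f_eq: "f - y_retract f = (if 1 \<le> m then mpol_y * hom_component (m - 1) f' else 0)"
      unfolding f' using hom_component_mult_homogeneous[of 1 mpol_y m f'] homogeneous_iff_hom_component[of m "mpol_y * f'"]
      by simp
    \<comment> \<open>From \<open>i < p\<close> and \<open>m + i + e = s\<close> follows
      \<open>m \<ge> e + 2 * r - 2\<close>, and \<open>e > 0\<close>.\<close>
    have "2 * r - 1 \<le> m"
      using step.hyps step.prems(1) e p3 unfolding s_def by linarith
    then have "mpol_y ^ i * (q * y_retract f) \<in> J"
      unfolding P(2) by (intro ring_module.subspace_scale[OF idJ] base P(1))
    moreover have "mpol_y ^ i * (q * (f - y_retract f)) \<in> J"
    proof (cases "1 \<le> m")
      case True
      have "mpol_y ^ Suc i * (q * hom_component (m - 1) f') \<in> J"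
        using True step.prems(1) by (intro step.IH[OF _ homogeneous_hom_component]) simp
      then show ?thesis using f_eq True by (simp add: mult_ac)
    next
      case False
      then show ?thesis using f_eq ring_module.subspace_0[OF idJ] by simp
    qed
    ultimately have "mpol_y ^ i * (q * y_retract f) + mpol_y ^ i * (q * (f - y_retract f)) \<in> J"
      by (rule ring_module.subspace_add[OF idJ])
    then show ?case by (simp add: algebra_simps)
  qed
  obtain w where w: "homogeneous (int s) w" "w \<notin> J"
    using top_form unfolding s_def by blast
  \<comment> \<open>Here \<open>k\<close> is the distance to the top degree \<open>s\<close>; each
    application of \<open>socle_J_max\<close> descends by one degree, ending at
    \<open>f = 1\<close>.\<close>
  have descend: "q * f \<in> J" if "m + e + k = s" "homogeneous (int m) f" for k m f
    using that
  proof (induction k arbitrary: m f)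
    case 0
    then show ?case using top[of 0 m f] by simp
  next
    case (Suc k)
    show ?case
    proof (rule socle_J_max[OF J _ _ _ w])
      show "homogeneous (int (e + m)) (q * f)"
        using homogeneous_mult[OF homogeneous_binary_form[of e g] Suc.prems(2)] by (simp add: q_def)
      show "e + m < s" using Suc.prems(1) by simp
      fix i
      have "homogeneous (int (Suc m)) (var i * f)"
        using homogeneous_mult[OF homogeneous_var Suc.prems(2)] by simp
      then have "q * (var i * f) \<in> J"
        using Suc.prems(1) by (intro Suc.IH) auto
      then show "var i * (q * f) \<in> J" by (simp add: mult.left_commute)
    qed
  qed
  have "0 + e + (s - e) = s" using e p3 unfolding s_def by simp
  then have "q \<in> J" using descend[of 0 "s - e" 1] homogeneous_1 by simp
  then have "q \<in> hom_part J e"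
    by (simp add: hom_part_def q_def homogeneous_binary_form)
  also have "hom_part J e = hom_part y_power_ideal e"
    using e r by (intro hom_part_low_degree) simp
  finally have "mpol_y ^ p dvd q" by (simp add: hom_part_def mem_y_power_ideal)
  then have "mpol_y dvd q"
    using p3 by (metis dvd_power dvd_trans gr_implies_not0 neq0_conv)
  then have "q = 0"
    using y_dvd_iff[OF three, of q] y_retract_binary_form[OF three] by (simp add: q_def)
  then have "g = 0"
    using binary_form_eq_0[of g e] e g(2) unfolding q_def by simp
  with g(1) show False by simp
qed

text \<open>By \<open>no_common_factor\<close> the degree of \<open>h1\<close> is all of
  \<open>d\<close>, so \<open>g\<close> is a nonzero constant and can be inverted in the Bezout
  representation.\<close>

lemma powers_in_ideal:
  fixes h1 h2 g :: "'a poly"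
  assumes bezout: "u * h1 + v * h2 = 1" "h1 \<noteq> 0" "degree h2 \<le> degree h1"
    and g: "g \<noteq> 0" "degree (g * h1) \<le> d"
    and deg: "degree h1 > 0"
    and forms: "binary_form d (g * h1) \<in> J" "binary_form d (g * h2) \<in> J"
    and f: "degree f \<le> 2 * d - 1"
  shows "\<exists>w1 w2. binary_form (2 * d - 1) f = w1 * binary_form d (g * h1) + w2 * binary_form d (g * h2)"
proof -
  have gd: "degree g + degree h1 \<le> d"
    using g bezout(2) by (simp add: degree_mult_eq)
  have r: "degree h1 = d"
    by (rule no_common_factor[OF bezout(1,2) refl bezout(3) g(1) gd deg forms])
  with gd obtain \<gamma> where \<gamma>: "g = [:\<gamma>:]" by (metis add_le_same_cancel2 degree_eq_zeroE le_zero_eq)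
  have "\<exists>w1 w2. binary_form (d - d) g * binary_form (2 * d - 1) f =
      w1 * binary_form d (g * h1) + w2 * binary_form d (g * h2)"
    using bezout r gd f by (intro ideal_of_bezout_forms[where u = u and v = v]) auto
  then obtain w1 w2 where "const \<gamma> * binary_form (2 * d - 1) f =
      w1 * binary_form d (g * h1) + w2 * binary_form d (g * h2)"
    by (auto simp: \<gamma> binary_form_def[of 0])
  then have "const (inverse \<gamma>) * (const \<gamma> * binary_form (2 * d - 1) f) =
      (const (inverse \<gamma>) * w1) * binary_form d (g * h1) + (const (inverse \<gamma>) * w2) * binary_form d (g * h2)"
    by (simp only: distrib_left mult.assoc)
  moreover have "const (inverse \<gamma>) * (const \<gamma> * binary_form (2 * d - 1) f) = binary_form (2 * d - 1) f"
    using g(1) unfolding \<gamma> mult.assoc[symmetric] const_mult[symmetric] by simp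
  ultimately show ?thesis by metis
qed

lemma generators_of_J:
  obtains g1 g2 where "homogeneous (int d) g1" "homogeneous (int d) g2" "g1 \<noteq> 0" "g2 \<noteq> 0"
    "regular_sequence [mpol_y ^ p, g1, g2]" "regular_sequence [g1, g2, mpol_y ^ p]"
    "J = ideal_generated {mpol_y ^ p, g1, g2}"
proof -
  note three = two_three_nonzero(2)
  obtain P1 P2 where P: "degree P1 \<le> d" "degree P2 \<le> d" "binary_form d P1 \<in> J" "binary_form d P2 \<in> J"
    and indep: "\<And>\<alpha> \<beta>. smult \<alpha> P1 + smult \<beta> P2 = 0 \<Longrightarrow> \<alpha> = 0 \<and> \<beta> = 0"
    using two_forms_in_J by blast
  have P0: "P1 \<noteq> 0" "P2 \<noteq> 0"
    using indep[of 1 0] indep[of 0 1] by auto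
  define g1 where "g1 = binary_form d P1"
  define g2 where "g2 = binary_form d P2"
  have hom: "homogeneous (int d) g1" "homogeneous (int d) g2"
    by (simp_all add: g1_def g2_def homogeneous_binary_form)
  have nonzero: "g1 \<noteq> 0" "g2 \<noteq> 0"
    using binary_form_eq_0[OF P(1)] binary_form_eq_0[OF P(2)] P0 by (auto simp: g1_def g2_def)
  obtain g h1 h2 u v where fac: "g \<noteq> 0" "P1 = g * h1" "P2 = g * h2" "u * h1 + v * h2 = 1"
    using poly_common_factor[of P1 P2] P0(1) by blast
  have h0: "h1 \<noteq> 0" "h2 \<noteq> 0" using P0 fac by auto
  \<comment> \<open>Constant \<open>h1\<close> and \<open>h2\<close> would make \<open>P1\<close>
    and \<open>P2\<close> proportional.\<close>
  have not_const: "degree h1 > 0 \<or> degree h2 > 0"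
  proof (rule ccontr)
    assume "\<not> ?thesis"
    then obtain a b where ab: "h1 = [:a:]" "h2 = [:b:]" by (metis degree_eq_zeroE neq0_conv)
    then have "smult b P1 + smult (- a) P2 = 0"
      unfolding fac by (simp add: mult.commute)
    with indep[of b "- a"] h0 ab show False by auto
  qed
  \<comment> \<open>The factor of larger degree takes the role of \<open>h1\<close>, which excludes
    a common zero at infinity.\<close>
  have powers: "\<exists>w1 w2. binary_form (2 * d - 1) f = w1 * g1 + w2 * g2" if "degree f \<le> 2 * d - 1" for f
  proof (cases "degree h2 \<le> degree h1")
    case True
    then show ?thesis
      using powers_in_ideal[of u h1 v h2 g f] fac h0 not_const P that unfolding g1_def g2_def by auto
  next
    case False
    then have "\<exists>w1 w2. binary_form (2 * d - 1) f = w1 * g2 + w2 * g1"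
      using powers_in_ideal[of v h2 u h1 g f] fac h0 P that unfolding g1_def g2_def
      by (auto simp: add.commute)
    then show ?thesis by (metis add.commute)
  qed
  have "binary_form (2 * d - 1) (monom 1 0) = (mpol_b ^ (2 * d - 1) :: (3, 'a) mpol)"
    by (subst binary_form_monom) simp_all
  then have gens: "\<exists>u v. mpol_a ^ (2 * d - 1) = u * g1 + v * g2" "\<exists>u v. mpol_b ^ (2 * d - 1) = u * g1 + v * g2"
    using powers[of "monom 1 (2 * d - 1)"] powers[of "monom 1 0"]
    by (simp_all add: binary_form_monom degree_monom_eq)
  have reg: "regular_sequence [mpol_y ^ p, g1, g2]" "regular_sequence [g1, g2, mpol_y ^ p]"
    using regular_sequences[OF three _ nonzero(1) _ gens hom d, of p] p3
      y_retract_binary_form[OF three] by (simp_all add: g1_def g2_def)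
  let ?I = "ideal_generated (set [mpol_y ^ p, g1, g2])"
  have idI: "ideal ?I" by (rule ring_module.subspace_span)
  have sub: "?I \<subseteq> J"
    by (rule ring_module.span_minimal[OF _ ideal_J_max[OF J]])
      (use P y_power_in_J in \<open>simp add: g1_def g2_def\<close>)
  have "hilbert ?I = (\<Prod>d\<leftarrow>[p, d, d]. 1 - fps_X ^ d) * hilbert {0 :: (3, 'a) mpol}"
    by (rule hilbert_regular_sequence)
      (use reg(1) hom nonzero homogeneous_y_power[of p] in \<open>auto simp: regular_sequence_def\<close>)
  \<comment> \<open>Together with \<open>?I \<subseteq> J\<close>, equal dimensions in every degree
    give equality.\<close>
  then have "hilbert ?I = hilbert J"
    unfolding hilbert_J by (simp add: power2_eq_square mult.assoc)
  then have parts: "hom_part ?I m = hom_part J m" for m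
    using hilbert_nth_eq_iff[of ?I m J] by (intro hom_part_eqI[OF idI sub]) simp
  have "J \<subseteq> ?I"
  proof (rule hom_parts_subset[OF idI])
    show "hom_part J m \<subseteq> ?I" for m
      unfolding parts[symmetric] by (auto simp: hom_part_def)
  qed (rule hom_component_J_max[OF J])
  with sub have "J = ideal_generated {mpol_y ^ p, g1, g2}" by simp
  with hom nonzero reg show thesis by (intro that)
qed

end

section \<open>Laurent series and the final case distinction\<close>

lemma fls_X_intpow_of_nat: "fls_X_intpow (int n) = (fps_to_fls (fps_X ^ n) :: rat fls)"
  by (simp add: fps_to_fls_power fls_X_power_conv_shift_1)

lemma fls_one_minus_X: "(1 - fls_X :: rat fls) = fps_to_fls (1 - fps_X)" "(1 - fls_X :: rat fls) \<noteq> 0"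
proof -
  show eq: "(1 - fls_X :: rat fls) = fps_to_fls (1 - fps_X)" by simp
  have "fps_nth (1 - fps_X :: rat fps) 0 \<noteq> 0" by simp
  then have "(1 - fps_X :: rat fps) \<noteq> 0" by (metis fps_zero_nth)
  then show "(1 - fls_X :: rat fls) \<noteq> 0"
    unfolding eq by (simp only: fps_to_fls_eq_0_iff not_False_eq_True)
qed

lemma fps_of_hilbert_product:
  assumes "fps_to_fls H = (\<Prod>d\<leftarrow>[d1, d2, d3]. (1 - fls_X_intpow d) / (1 - fls_X) :: rat fls)"
  shows "fps_to_fls ((1 - fps_X) ^ 3 * H) = (1 - fls_X_intpow d1) * (1 - fls_X_intpow d2) * (1 - fls_X_intpow d3)"
proof -
  have "fps_to_fls ((1 - fps_X) ^ 3 * H) = (1 - fls_X) ^ 3 * fps_to_fls H"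
    by (simp only: fls_times_fps_to_fls fps_to_fls_power fls_one_minus_X(1))
  moreover have "z ^ 3 * (a / z * (b / z * (c / z))) = a * b * c" if "z \<noteq> 0" for a b c z :: "rat fls"
    using that by (simp add: power3_eq_cube)
  ultimately show ?thesis
    unfolding assms using fls_one_minus_X(2) by simp
qed

text \<open>After multiplication by \<open>fps_X ^ (2 * k)\<close> and clearing of denominators, the
  constant coefficient is 0 on the left and 1 on the right. This rules out the triple with negative
  degrees.\<close>

lemma hilbert_product_no_pole:
  fixes H :: "rat fps"
  assumes "fps_to_fls H = (\<Prod>d\<leftarrow>[- int k, - int k, int n]. (1 - fls_X_intpow d) / (1 - fls_X))"
    and "k > 0" "n > 0"
  shows False
proof -
  let ?x = "fls_X_intpow (int k) :: rat fls" and ?x' = "fls_X_intpow (- int k) :: rat fls"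
  have inv: "?x * ?x' = 1"
    unfolding fls_X_intpow_times_fls_X_intpow by simp
  have "fps_to_fls (fps_X ^ k * fps_X ^ k * ((1 - fps_X) ^ 3 * H)) =
      ?x * ?x * ((1 - ?x') * (1 - ?x') * (1 - fls_X_intpow (int n)))"
    unfolding fls_times_fps_to_fls[of "fps_X ^ k * fps_X ^ k"] fps_of_hilbert_product[OF assms(1)]
    by (simp only: fls_times_fps_to_fls fls_X_intpow_of_nat)
  also have "\<dots> = (?x - ?x * ?x') * (?x - ?x * ?x') * (1 - fls_X_intpow (int n))"
    by algebra
  also have "\<dots> = fps_to_fls ((fps_X ^ k - 1) * (fps_X ^ k - 1) * (1 - fps_X ^ n))"
    unfolding inv unfolding fls_X_intpow_of_nat by (simp add: fls_times_fps_to_fls)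
  finally have "fps_X ^ k * fps_X ^ k * ((1 - fps_X) ^ 3 * H) = (fps_X ^ k - 1) * (fps_X ^ k - 1) * (1 - fps_X ^ n)"
    by (simp only: fps_to_fls_eq_iff)
  from arg_cong[OF this, of "\<lambda>f. fps_nth f 0"] show False
    using assms(2,3) by (simp add: fps_mult_nth_0)
qed

theorem theorem3p3:
  fixes p c :: nat and d1 d2 d3 :: int
    and J :: "(3, 'a::field) mpol set"
  assumes "prime p" and "p > 3" and "CHAR('a) = p"
    and "0 < c" and "c < p"
    and "J = J_max (of_nat c)"
    and "degree_case p c d1 d2 d3"
    and "quotient_hilbert_series J = (\<Prod>d\<leftarrow>[d1, d2, d3]. (1 - fls_X_intpow d) / (1 - fls_X))"
  shows "complete_intersection_of_degrees [d1, d2, d3] J"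
proof -
  have series: "fps_to_fls (hilbert J) = (\<Prod>d\<leftarrow>[d1, d2, d3]. (1 - fls_X_intpow d) / (1 - fls_X))"
    using assms(8) unfolding quotient_hilbert_series_eq .
  have three: "(3 :: 'a) \<noteq> 0"
    using assms(2,3) of_nat_eq_0_iff_char_dvd[of 3, where 'a = 'a] by (auto dest: dvd_imp_le)
  have generators: thesis
    if "d > 0"
      and ds: "(d1, d2, d3) = (int p, int d, int d) \<or> (d1, d2, d3) = (int d, int d, int p)"
      and thesis: "\<And>g1 g2 :: (3, 'a) mpol. \<lbrakk>homogeneous (int d) g1; homogeneous (int d) g2; g1 \<noteq> 0; g2 \<noteq> 0;
        regular_sequence [mpol_y ^ p, g1, g2]; regular_sequence [g1, g2, mpol_y ^ p];
        J = ideal_generated {mpol_y ^ p, g1, g2}\<rbrakk> \<Longrightarrow> thesis"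
    for d thesis
  proof -
    have "fps_to_fls ((1 - fps_X) ^ 3 * hilbert J) = fps_to_fls ((1 - fps_X ^ p) * (1 - fps_X ^ d) ^ 2)"
      unfolding fps_of_hilbert_product[OF series] using ds
      by (auto simp: fls_X_intpow_of_nat fls_times_fps_to_fls power2_eq_square)
    then have "(1 - fps_X) ^ 3 * hilbert J = (1 - fps_X ^ p) * (1 - fps_X ^ d) ^ 2"
      by (simp only: fps_to_fls_eq_iff)
    \<comment> \<open>The factor equals 1; it trades the denominator for \<open>hilbert {0}\<close>,
      as \<open>generators_of_J\<close> expects.\<close>
    moreover have "hilbert J = (1 - fps_X) ^ 3 * hilbert {0 :: (3, 'a) mpol} * hilbert J"
      by (simp add: hilbert_zero_ideal[OF three])
    ultimately have "hilbert J = (1 - fps_X ^ p) * (1 - fps_X ^ d) ^ 2 * hilbert {0 :: (3, 'a) mpol}"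
      by (metis mult.assoc mult.commute)
    from generators_of_J[OF assms(2,3,6) \<open>d > 0\<close> this] show thesis
      using thesis by blast
  qed
  have y: "homogeneous (int p) (mpol_y ^ p :: (3, 'a) mpol)"
    using homogeneous_power[OF homogeneous_yab(1), of p] by simp
  \<comment> \<open>The case \<open>last\<close> unites the second range and the corrected third
    triple; \<open>pole\<close> is the printed third triple.\<close>
  consider (first) "3 * c < p" "(d1, d2, d3) = (int p, int (p + 3 * c), int (p + 3 * c))"
    | (last) d where "d > 0" "(d1, d2, d3) = (int d, int d, int p)"
    | (pole) "(d1, d2, d3) = (- int (3 * c - p), - int (3 * c - p), int p)" "3 * c > p"
    using assms(7) unfolding degree_case_def
  proof (elim disjE conjE)
    assume "p < 3 * c" "(d1, d2, d3) = (3 * int c - int p, 3 * int c - int p, int p)"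
    then show thesis by (intro last[of "3 * c - p"]) auto
  next
    assume "2 * p < 3 * c" "(d1, d2, d3) = (3 * int c - 2 * int p, 3 * int c - 2 * int p, int p)"
    then show thesis by (intro last[of "3 * c - 2 * p"]) auto
  next
    assume "2 * p < 3 * c" "(d1, d2, d3) = (int p - 3 * int c, int p - 3 * int c, int p)"
    then show thesis by (intro pole) auto
  qed (use first in auto)
  then show ?thesis
  proof cases
    case first
    show ?thesis
    proof (rule generators[of "p + 3 * c"])
      fix g1 g2 :: "(3, 'a) mpol"
      assume "homogeneous (int (p + 3 * c)) g1" "homogeneous (int (p + 3 * c)) g2" "g1 \<noteq> 0" "g2 \<noteq> 0"
        "regular_sequence [mpol_y ^ p, g1, g2]" "J = ideal_generated {mpol_y ^ p, g1, g2}"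
      then show ?thesis
        unfolding complete_intersection_of_degrees_def using first(2) y
        by (intro exI[of _ "[mpol_y ^ p, g1, g2]"]) simp
    qed (use first assms(2) in auto)
  next
    case (last d)
    show ?thesis
    proof (rule generators[of d])
      fix g1 g2 :: "(3, 'a) mpol"
      assume "homogeneous (int d) g1" "homogeneous (int d) g2" "g1 \<noteq> 0" "g2 \<noteq> 0"
        "regular_sequence [g1, g2, mpol_y ^ p]" "J = ideal_generated {mpol_y ^ p, g1, g2}"
      then show ?thesis
        unfolding complete_intersection_of_degrees_def using last(2) y
        by (intro exI[of _ "[g1, g2, mpol_y ^ p]"]) (simp add: insert_commute)
    qed (use last in auto)
  next
    case pole
    have "False"
      using hilbert_product_no_pole[of "hilbert J" "3 * c - p" p] series pole assms(2) by simp
    then show ?thesis ..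
  qed
qed

end
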